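(* For every integer $d\geq 2$ and every $\varepsilon>0$ there exists a positive integer $n_0=n_0(d,\varepsilon)$ such that for every $n\geq n_0$, if $\mathcal{G}\subseteq\mathbb{F}_2^{\binom{[n]}{\leq 2}}$ is a $\mathcal{C}^\circ$-HJ-code with $\mathbb{P}[\mathcal{G}]=\Delta^\circ_n(\mathcal{C}^\circ)$, then $$\big\|\mathbb{1}_{\mathcal{G}}-\mathbb{P}[\mathcal{G}]\big\|_{U_d}\leq\varepsilon.$$
   Context: Graphs: for a nonempty finite set $V$, $\binom{V}{\leq 2}$ denotes the set of nonempty subsets of $V$ with at most two elements. A graph on $V$ is a subset of $\binom{V}{\leq 2}$ (elements of size 2 are edges, of size 1 self-loops). The spanning vertex set $V(G)$ is the union of the members of $G$. Graphs $G,H$ are isomorphic if there is a bijection $\phi\colon V(G)\to V(H)$ with $\{x,y\}\in G\iff\{\phi(x),\phi(y)\}\in H$ for all $x,y\in V(G)$ (including $x=y$). Graphs on $[n]$ are identified with elements of $\mathbb{F}_2^{\binom{[n]}{\leq 2}}$ via indicators; $G_1+G_2$ denotes symmetric difference; $\mathbb{P}$ is the uniform probability measure on $\mathbb{F}_2^{\binom{[n]}{\leq 2}}$ and $\mathbb{E}$ its expectation. $K_r^\circ:=\binom{[r]}{\leq 2}$ is the complete graph on $r$ vertices with all self-loops, and $\mathcal{C}^\circ:=\{K_r^\circ: r\geq 1\}$. A family $\mathcal{G}$ of graphs on a common vertex set is a $\mathcal{C}^\circ$-HJ-code if for all $G_1,G_2\in\mathcal{G}$ with $G_1\supseteq G_2$,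 the graph $G_1+G_2$ is not isomorphic to any graph in $\mathcal{C}^\circ$. $\Delta^\circ_n(\mathcal{C}^\circ)$ is the maximum of $\mathbb{P}[\mathcal{G}]$ over all $\mathcal{C}^\circ$-HJ-codes $\mathcal{G}\subseteq\mathbb{F}_2^{\binom{[n]}{\leq 2}}$. Gowers norm: for a nonempty finite set $\mathcal{I}$, $d\geq 2$ and $f\colon\mathbb{F}_2^{\mathcal{I}}\to\mathbb{C}$, $\|f\|_{U_d}=\Big|\mathbb{E}_{x,y_1,\dots,y_d\in\mathbb{F}_2^{\mathcal{I}}}\prod_{s\subseteq[d]}\mathcal{C}^{|s|}f\big(x+\sum_{i\in s}y_i\big)\Big|^{1/2^d}$, where $\mathcal{C}$ is complex conjugation. *)

theory Defs
  imports "HOL-Analysis.Analysis"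
begin

text \<open>Graphs are sets of nonempty vertex sets of size at most 2 (vertices are naturals).
  The index set binom([n], \<le>2) is pairs_upto n, with [n] = {1..n}.
  An element of F_2^I is represented as a subset of I; addition is symmetric difference.\<close>

definition le2_subsets :: "nat set \<Rightarrow> nat set set" where
  "le2_subsets V = {e. e \<subseteq> V \<and> e \<noteq> {} \<and> card e \<le> 2}"

definition pairs_upto :: "nat \<Rightarrow> nat set set" where
  "pairs_upto n = le2_subsets {1..n}"

definition symdiff :: "'a set \<Rightarrow> 'a set \<Rightarrow> 'a set" where
  "symdiff A B = (A - B) \<union> (B - A)"

definition vset :: "nat set set \<Rightarrow> nat set" where
  "vset G = \<Union> G"

definition graph_iso :: "nat set set \<Rightarrow> nat set set \<Rightarrow> bool" where
  "graph_iso G H \<longleftrightarrow> (\<exists>\<phi>. bij_betw \<phi> (vset G) (vset H) \<and>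
     (\<forall>x\<in>vset G. \<forall>y\<in>vset G. {x, y} \<in> G \<longleftrightarrow> {\<phi> x, \<phi> y} \<in> H))"

definition Kloop :: "nat \<Rightarrow> nat set set" where
  "Kloop r = le2_subsets {1..r}"

definition Cloop :: "nat set set set" where
  "Cloop = {Kloop r | r. r \<ge> 1}"

definition HJ_code :: "nat set set set \<Rightarrow> bool" where
  "HJ_code \<G> \<longleftrightarrow> (\<forall>G1\<in>\<G>. \<forall>G2\<in>\<G>. G2 \<subseteq> G1 \<longrightarrow>
      \<not> (\<exists>K\<in>Cloop. graph_iso (symdiff G1 G2) K))"

definition prob_n :: "nat \<Rightarrow> nat set set set \<Rightarrow> real" where
  "prob_n n \<G> = real (card (\<G> \<inter> Pow (pairs_upto n))) / 2 ^ card (pairs_upto n)"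

definition Delta_loop :: "nat \<Rightarrow> real" where
  "Delta_loop n = Max (prob_n n ` {\<G>. \<G> \<subseteq> Pow (pairs_upto n) \<and> HJ_code \<G>})"

fun sdsum :: "'a set list \<Rightarrow> 'a set" where
  "sdsum [] = {}"
| "sdsum (A # As) = symdiff A (sdsum As)"

definition gowers_norm :: "'a set \<Rightarrow> nat \<Rightarrow> ('a set \<Rightarrow> complex) \<Rightarrow> real" where
  "gowers_norm I d f =
     cmod ((\<Sum>x\<in>Pow I. \<Sum>ys\<in>{ys. length ys = d \<and> set ys \<subseteq> Pow I}.
        \<Prod>s\<in>Pow {..<d}.
          (if even (card s) then id else cnj)
            (f (symdiff x (sdsum (map (\<lambda>i. ys ! i) (sorted_list_of_set s))))))
       / (2 ^ (card I * (d + 1))))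
     powr (1 / 2 ^ d)"

end

(*
  If f = 1_G - a has large U_(k+1) norm, then a
  blow-up structure of any prescribed size M, planted in f, has large U_k norm on average, with a bound
  that does not depend on M. To see this, let mu(Y) be the mean of the k-fold multiplicative derivative of f
  along Y = (Y_1, ..., Y_k).
  (1) By positive definiteness every tuple of shifts can be corrected, each entry by one of boundedly many
  elements, to a tuple Y with |mu(Y)| bounded below.
  (2) By Bessel's inequality for disjoint sets of coordinates there is a block of vertices such that
  conditioning X on the edges in the block hardly changes the mean of the derivative at X, for nearly all Y.
  (3) Colour the shifts supported on the block by the corrections used and by the sign of mu(Y). The number
  of colours does not depend on the block, so an affine quadratic Hales-Jewett theorem yields a blow-up
  structure on whose translate the colouring is constant.
  (4) The corrections of a shift depend on the previous shifts only, so Cauchy-Schwarz removes all factors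
  except the values of f on the blow-up structure, planted with value 0 in the block thanks to (2).
  Blow-ups pull codes back to codes, so all densities stay below Delta_M. Hence planted structures can be chosen
  with nearly extremal density and large U_k norm, and descending to U_1, which is the square of the mean,
  gives a contradiction.
*)

theory Submission
  imports Defs "HOL-Library.Function_Algebras" "HOL-Library.Z2"
begin

section \<open>An affine quadratic Hales--Jewett theorem\<close>

text \<open>What shapes the proof is the order of the constants. The induction on the degree chooses
  M only after the lower bound for the planted norm is known, so this bound must not depend on M.
  Here M only affects how far the Hales-Jewett theorem has to search.

  Hales-Jewett gives no control over where its structure lands. Hence a correction has to exist for
  every tuple of shifts, not just for most of them, and this is what positive definiteness supplies.
  Likewise conditioning must be harmless at every point of the block and for every tuple that can
  occur. Their number is bounded in terms of the block, so a generic translate avoids the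
  exceptional ones. The translate found by Hales-Jewett enters only the directions of the
  derivative, never its base point, and so leaves no trace in the planted copy.

  Loops are what lets cliques survive a blow-up: two copies of a vertex are joined exactly when its
  loop is present, so a looped clique becomes a looped clique on the preimage.\<close>

definition quad_eval :: "(nat \<Rightarrow> nat \<Rightarrow> 'g::ab_group_add) \<times> (nat \<Rightarrow> 'g) \<Rightarrow> nat set \<Rightarrow> 'g" where
  "quad_eval q B = (\<Sum>j\<in>B. snd q j + (\<Sum>i\<in>{i\<in>B. i < j}. fst q i j))"

text \<open>\<open>quad_eval q\<close> is a polynomial of degree at most 2 in the indicator of its
  argument, without constant term; \<open>fst q\<close> holds the coefficients of pairs,
  \<open>snd q\<close> those of single elements. Once \<open>D\<close> is fixed, the pair terms
  between \<open>D\<close> and later elements become linear. As in proofs of van der Waerden's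
  theorem, one map \<open>h\<close> is subtracted from all the others.\<close>

definition quad_shift :: "(nat \<Rightarrow> nat \<Rightarrow> 'g::ab_group_add) \<times> (nat \<Rightarrow> 'g) \<Rightarrow>
    (nat \<Rightarrow> nat \<Rightarrow> 'g) \<times> (nat \<Rightarrow> 'g) \<Rightarrow> nat set \<Rightarrow> (nat \<Rightarrow> nat \<Rightarrow> 'g) \<times> (nat \<Rightarrow> 'g)" where
  "quad_shift h q D = (\<lambda>i j. fst q i j - fst h i j, \<lambda>j. snd q j + (\<Sum>i\<in>D. fst q i j) - snd h j)"

lemma quad_eval_union:
  assumes "finite B" "finite B'" "\<And>i j. i \<in> B \<Longrightarrow> j \<in> B' \<Longrightarrow> i < j"
  shows "quad_eval q (B \<union> B') = quad_eval q B + quad_eval h B' + quad_eval (quad_shift h q B) B'"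
proof -
  have dis: "B \<inter> B' = {}" using assms(3) by fastforce
  have 1: "{i \<in> B \<union> B'. i < j} = {i\<in>B. i < j}" if "j \<in> B" for j
    using assms(3) that by fastforce
  have 2: "(\<Sum>i\<in>{i \<in> B \<union> B'. i < j}. fst q i j) = (\<Sum>i\<in>B. fst q i j) + (\<Sum>i\<in>{i\<in>B'. i < j}. fst q i j)"
    if "j \<in> B'" for j
  proof -
    have "{i \<in> B \<union> B'. i < j} = B \<union> {i\<in>B'. i < j}" using assms(3) that by blast
    then show ?thesis using assms dis by (simp add: sum.union_disjoint disjoint_iff)
  qed
  have "quad_eval q (B \<union> B') = quad_eval q B + (\<Sum>j\<in>B'. snd q j + ((\<Sum>i\<in>B. fst q i j) + (\<Sum>i\<in>{i\<in>B'. i < j}. fst q i j)))"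
    unfolding quad_eval_def by (subst sum.union_disjoint) (use assms dis 1 2 in auto)
  also have "(\<Sum>j\<in>B'. snd q j + ((\<Sum>i\<in>B. fst q i j) + (\<Sum>i\<in>{i\<in>B'. i < j}. fst q i j))) =
      quad_eval h B' + quad_eval (quad_shift h q B) B'"
    unfolding quad_eval_def quad_shift_def
    by (simp add: sum.distrib[symmetric] sum_subtractf algebra_simps)
  finally show ?thesis by (simp add: add.assoc)
qed

text \<open>\<open>N\<close> and the finite set \<open>C\<close> precede the colouring, so colour
  patterns on a finite set can later serve as colours themselves. The lower end \<open>s\<close>
  allows a new block to be placed after those already in use.\<close>

definition poly_HJ :: "((nat \<Rightarrow> nat \<Rightarrow> 'g::ab_group_add) \<times> (nat \<Rightarrow> 'g)) set \<Rightarrow> bool" where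
  "poly_HJ Q \<longleftrightarrow> (\<forall>r s. \<exists>N C. finite C \<and> (\<forall>col::'g \<Rightarrow> nat. (\<forall>g. col g < r) \<longrightarrow>
     (\<exists>z\<in>C. \<exists>B. B \<subseteq> {s..<N} \<and> B \<noteq> {} \<and> (\<forall>q\<in>Q. col (z + quad_eval q B) = col z))))"

lemma poly_HJ_finite_colours:
  assumes "poly_HJ Q" "finite X"
  obtains N C where "finite C"
    "\<And>col::'g::ab_group_add \<Rightarrow> 'c. (\<And>g. col g \<in> X) \<Longrightarrow>
      \<exists>z\<in>C. \<exists>B. B \<subseteq> {s..<N} \<and> B \<noteq> {} \<and> (\<forall>q\<in>Q. col (z + quad_eval q B) = col z)"
proof -
  obtain e :: "'c \<Rightarrow> nat" where e: "bij_betw e X {0..<card X}"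
    using ex_bij_betw_finite_nat[OF assms(2)] by blast
  have "\<exists>N C. finite C \<and> (\<forall>col::'g \<Rightarrow> nat. (\<forall>g. col g < card X) \<longrightarrow>
     (\<exists>z\<in>C. \<exists>B. B \<subseteq> {s..<N} \<and> B \<noteq> {} \<and> (\<forall>q\<in>Q. col (z + quad_eval q B) = col z)))"
    using assms(1)[unfolded poly_HJ_def, THEN spec[where x="card X"], THEN spec[where x=s]] .
  then obtain N C where NC: "finite C" "\<And>col::'g \<Rightarrow> nat. (\<forall>g. col g < card X) \<Longrightarrow>
     (\<exists>z\<in>C. \<exists>B. B \<subseteq> {s..<N} \<and> B \<noteq> {} \<and> (\<forall>q\<in>Q. col (z + quad_eval q B) = col z))"
    by blast
  show thesis
  proof (rule that[OF NC(1)])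
    fix col :: "'g \<Rightarrow> 'c" assume col: "\<And>g. col g \<in> X"
    have "\<forall>g. e (col g) < card X" using col bij_betwE[OF e] by fastforce
    from NC(2)[OF this] show "\<exists>z\<in>C. \<exists>B. B \<subseteq> {s..<N} \<and> B \<noteq> {} \<and> (\<forall>q\<in>Q. col (z + quad_eval q B) = col z)"
      using col bij_betw_imp_inj_on[OF e] by (meson inj_on_eq_iff)
  qed
qed

text \<open>Colour focusing: \<open>z\<close> is the common focus of \<open>t\<close> monochromatic
  structures whose colours are distinct and differ from the colour of \<open>z\<close>.\<close>

definition focused :: "((nat \<Rightarrow> nat \<Rightarrow> 'g::ab_group_add) \<times> (nat \<Rightarrow> 'g)) set \<Rightarrow> nat \<Rightarrow> nat \<Rightarrow> ('g \<Rightarrow> nat) \<Rightarrow> nat \<Rightarrow> 'g \<Rightarrow> bool" where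
  "focused Q s N col t z \<longleftrightarrow> (\<exists>T. finite T \<and> card T = t \<and> col z \<notin> T \<and>
      (\<forall>c\<in>T. \<exists>B. B \<subseteq> {s..<N} \<and> B \<noteq> {} \<and> (\<forall>q\<in>Q. col (z + quad_eval q B) = c)))"

text \<open>The shifted family is applied to the colouring of \<open>g\<close> by the pattern of
  colours around \<open>g\<close>. This gives \<open>B2\<close> such that, seen from the new focus,
  each \<open>B \<union> B2\<close> keeps the colour of the old structure \<open>B\<close>, while
  \<open>B2\<close> alone has the colour of the old focus. So one more colour is focused, unless the
  new focus has one of these colours and the proof is complete.\<close>

lemma focused_step:
  fixes Q :: "((nat \<Rightarrow> nat \<Rightarrow> 'g::ab_group_add) \<times> (nat \<Rightarrow> 'g)) set"
  assumes fin: "finite Q"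
    and low: "\<And>D. finite D \<Longrightarrow> poly_HJ (\<Union>q\<in>Q. quad_shift h q ` Pow D)"
  shows "\<exists>N C. finite C \<and> (\<forall>col. (\<forall>g. col g < r) \<longrightarrow>
     (\<exists>z\<in>C. (\<exists>B. B \<subseteq> {s..<N} \<and> B \<noteq> {} \<and> (\<forall>q\<in>Q. col (z + quad_eval q B) = col z)) \<or> focused Q s N col t z))"
proof (induction t)
  case 0
  have "focused Q s s col 0 0" for col :: "'g \<Rightarrow> nat"
    unfolding focused_def by (intro exI[of _ "{}"]) simp
  then show ?case by (intro exI[of _ s] exI[of _ "{0}"]) simp
next
  case (Suc t)
  then obtain N1 and C1 :: "'g set" where C1: "finite C1"
    and IH: "\<And>col. \<forall>g. col g < r \<Longrightarrow>
     (\<exists>z\<in>C1. (\<exists>B. B \<subseteq> {s..<N1} \<and> B \<noteq> {} \<and> (\<forall>q\<in>Q. col (z + quad_eval q B) = col z)) \<or> focused Q s N1 col t z)"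
    by blast
  define Q' where "Q' = (\<Union>q\<in>Q. quad_shift h q ` Pow {s..<N1})"
  \<comment> \<open>The possible positions of the old focus and of all points of the old structures.
    Equal patterns on \<open>C'\<close> preserve their colours.\<close>
  define C' where "C' = C1 \<union> (\<lambda>(z, q, B). z + quad_eval q B) ` (C1 \<times> Q \<times> Pow {s..<N1})"
  have C': "finite C'" unfolding C'_def using C1 fin by auto
  have "finite (C' \<rightarrow>\<^sub>E {..<r})" using C' by (intro finite_PiE) auto
  moreover have "poly_HJ Q'" unfolding Q'_def by (rule low) simp
  ultimately obtain N2 C2 where C2: "finite C2"
    and 2: "\<And>col::'g \<Rightarrow> 'g \<Rightarrow> nat. (\<And>g. col g \<in> C' \<rightarrow>\<^sub>E {..<r}) \<Longrightarrow>
      \<exists>z\<in>C2. \<exists>B. B \<subseteq> {max s N1..<N2} \<and> B \<noteq> {} \<and> (\<forall>q\<in>Q'. col (z + quad_eval q B) = col z)"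
    using poly_HJ_finite_colours[where s = "max s N1"] by metis
  define N where "N = max N1 N2"
  define C where "C = (\<lambda>(z1, z2). z1 + z2) ` (C1 \<times> C2) \<union>
     (\<lambda>(z1, z2, B). z1 + z2 - quad_eval h B) ` (C1 \<times> C2 \<times> Pow {max s N1..<N2})"
  have "finite C" unfolding C_def using C1 C2 by auto
  moreover have "\<exists>z\<in>C. (\<exists>B. B \<subseteq> {s..<N} \<and> B \<noteq> {} \<and> (\<forall>q\<in>Q. col (z + quad_eval q B) = col z)) \<or> focused Q s N col (Suc t) z"
    if col: "\<forall>g. col g < r" for col :: "'g \<Rightarrow> nat"
  proof -
    have "\<exists>z\<in>C2. \<exists>B. B \<subseteq> {max s N1..<N2} \<and> B \<noteq> {} \<and>
        (\<forall>q\<in>Q'. restrict (\<lambda>c. col (z + quad_eval q B + c)) C' = restrict (\<lambda>c. col (z + c)) C')"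
      using col by (intro 2[of "\<lambda>g. restrict (\<lambda>c. col (g + c)) C'"]) auto
    then obtain z2 B2 where z2: "z2 \<in> C2" and B2: "B2 \<subseteq> {max s N1..<N2}" "B2 \<noteq> {}"
      and eq: "\<And>q. q \<in> Q' \<Longrightarrow> restrict (\<lambda>c. col (z2 + quad_eval q B2 + c)) C' = restrict (\<lambda>c. col (z2 + c)) C'"
      by blast
    have eq': "col (z2 + quad_eval q B2 + c) = col (z2 + c)" if "q \<in> Q'" "c \<in> C'" for q c
      using eq[OF that(1)] that(2) by (metis restrict_apply')
    have finB2: "finite B2" using B2(1) finite_subset by blast
    from IH[of "\<lambda>g. col (z2 + g)"] col obtain z1 where z1: "z1 \<in> C1"
      and alt: "(\<exists>B. B \<subseteq> {s..<N1} \<and> B \<noteq> {} \<and> (\<forall>q\<in>Q. col (z2 + (z1 + quad_eval q B)) = col (z2 + z1)))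
          \<or> focused Q s N1 (\<lambda>g. col (z2 + g)) t z1" by auto
    show ?thesis
      using alt
    proof
      assume "\<exists>B. B \<subseteq> {s..<N1} \<and> B \<noteq> {} \<and> (\<forall>q\<in>Q. col (z2 + (z1 + quad_eval q B)) = col (z2 + z1))"
      then obtain B where "B \<subseteq> {s..<N1}" "B \<noteq> {}" "\<forall>q\<in>Q. col (z2 + (z1 + quad_eval q B)) = col (z2 + z1)" by blast
      then have "B \<subseteq> {s..<N} \<and> B \<noteq> {} \<and> (\<forall>q\<in>Q. col ((z1 + z2) + quad_eval q B) = col (z1 + z2))"
        unfolding N_def by (fastforce simp: ac_simps)
      moreover have "z1 + z2 \<in> C" unfolding C_def using z1 z2 by auto
      ultimately show ?thesis by blast
    next
      assume "focused Q s N1 (\<lambda>g. col (z2 + g)) t z1"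
      then obtain T where T: "finite T" "card T = t" "col (z2 + z1) \<notin> T"
        and TB: "\<And>c. c \<in> T \<Longrightarrow> \<exists>B. B \<subseteq> {s..<N1} \<and> B \<noteq> {} \<and> (\<forall>q\<in>Q. col (z2 + (z1 + quad_eval q B)) = c)"
        unfolding focused_def by blast
      \<comment> \<open>Subtracting \<open>quad_eval h B2\<close> cancels the term for
        \<open>h\<close> that \<open>quad_eval_union\<close> splits off, so only the shifted map is
        evaluated at \<open>B2\<close>.\<close>
      define z where "z = z1 + z2 - quad_eval h B2"
      have zC: "z \<in> C" unfolding C_def z_def using z1 z2 B2 by force
      have key: "col (z + quad_eval q (B \<union> B2)) = col (z2 + (z1 + quad_eval q B))"
        if "q \<in> Q" "B \<subseteq> {s..<N1}" "B = {} \<or> B \<noteq> {}" for q B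
      proof -
        have fB: "finite B" using that(2) finite_subset by blast
        have "quad_eval q (B \<union> B2) = quad_eval q B + quad_eval h B2 + quad_eval (quad_shift h q B) B2"
          by (rule quad_eval_union) (use fB finB2 that B2 in \<open>force+\<close>)
        then have "z + quad_eval q (B \<union> B2) = z2 + quad_eval (quad_shift h q B) B2 + (z1 + quad_eval q B)"
          unfolding z_def by (simp add: algebra_simps)
        moreover have "quad_shift h q B \<in> Q'" unfolding Q'_def using that by blast
        moreover have "z1 + quad_eval q B \<in> C'" unfolding C'_def using z1 that by force
        ultimately show ?thesis using eq' by metis
      qed
      \<comment> \<open>The empty \<open>B\<close> turns the old focus into a structure of its own
        colour.\<close>
      have new: "col (z + quad_eval q B2) = col (z2 + z1)" if "q \<in> Q" for q
        using key[OF that, of "{}"] by (simp add: quad_eval_def)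
      define T' where "T' = insert (col (z2 + z1)) T"
      have B2N: "B2 \<subseteq> {s..<N}" using B2 unfolding N_def by fastforce
      have T'B: "\<exists>B. B \<subseteq> {s..<N} \<and> B \<noteq> {} \<and> (\<forall>q\<in>Q. col (z + quad_eval q B) = c)" if "c \<in> T'" for c
      proof (cases "c = col (z2 + z1)")
        case True
        then show ?thesis using B2N B2 new by metis
      next
        case False
        then have "c \<in> T" using that unfolding T'_def by simp
        then obtain B where B: "B \<subseteq> {s..<N1}" "B \<noteq> {}" "\<forall>q\<in>Q. col (z2 + (z1 + quad_eval q B)) = c"
          using TB by blast
        have "B \<union> B2 \<subseteq> {s..<N}" using B B2N unfolding N_def by force
        then show ?thesis using B key by (intro exI[of _ "B \<union> B2"]) auto
      qed
      have T': "finite T'" "card T' = Suc t" unfolding T'_def using T by auto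
      show ?thesis
      proof (cases "col z \<in> T'")
        case True
        show ?thesis by (rule bexI[OF _ zC], rule disjI1, rule T'B[OF True])
      next
        case False
        have "focused Q s N col (Suc t) z" unfolding focused_def
          by (intro exI[of _ T'] conjI ballI T' False T'B)
        then show ?thesis using zC by blast
      qed
    qed
  qed
  ultimately show ?case by blast
qed

text \<open>When all \<open>r\<close> colours are focused, none is left for the focus, so the other
  alternative of \<open>focused_step\<close> must hold.\<close>

lemma poly_HJ_of_shift:
  fixes Q :: "((nat \<Rightarrow> nat \<Rightarrow> 'g::ab_group_add) \<times> (nat \<Rightarrow> 'g)) set"
  assumes "finite Q" "\<And>D. finite D \<Longrightarrow> poly_HJ (\<Union>q\<in>Q. quad_shift h q ` Pow D)"
  shows "poly_HJ Q"
  unfolding poly_HJ_def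
proof (intro allI)
  fix r s
  obtain N C where C: "finite C" and *: "\<And>col. \<forall>g. col g < r \<Longrightarrow>
     (\<exists>z\<in>C. (\<exists>B. B \<subseteq> {s..<N} \<and> B \<noteq> {} \<and> (\<forall>q\<in>Q. col (z + quad_eval q B) = col z)) \<or> focused Q s N col r z)"
    using focused_step[OF assms, of r s r] by blast
  have "\<not> focused Q s N col r z" if "\<forall>g. col g < r" "Q \<noteq> {}" for col z
  proof
    assume "focused Q s N col r z"
    then obtain T where T: "finite T" "card T = r" "col z \<notin> T"
      and TB: "\<And>c. c \<in> T \<Longrightarrow> \<exists>B. B \<subseteq> {s..<N} \<and> B \<noteq> {} \<and> (\<forall>q\<in>Q. col (z + quad_eval q B) = c)"
      unfolding focused_def by blast
    have "T \<subseteq> {..<r}"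
    proof
      fix c assume "c \<in> T"
      then obtain B where "\<forall>q\<in>Q. col (z + quad_eval q B) = c" using TB by blast
      then show "c \<in> {..<r}" using that by (metis all_not_in_conv lessThan_iff)
    qed
    then have "T = {..<r}" using T by (intro card_subset_eq) auto
    then show False using T that by auto
  qed
  then have *: "\<exists>z\<in>C. \<exists>B. B \<subseteq> {s..<N} \<and> B \<noteq> {} \<and> (\<forall>q\<in>Q. col (z + quad_eval q B) = col z)"
    if "\<forall>g. col g < r" "Q \<noteq> {}" for col
    using *[OF that(1)] that by metis
  show "\<exists>N C. finite C \<and> (\<forall>col::'g \<Rightarrow> nat. (\<forall>g. col g < r) \<longrightarrow>
     (\<exists>z\<in>C. \<exists>B. B \<subseteq> {s..<N} \<and> B \<noteq> {} \<and> (\<forall>q\<in>Q. col (z + quad_eval q B) = col z)))"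
  proof (cases "Q = {}")
    case True
    then show ?thesis by (intro exI[of _ "Suc s"] exI[of _ "{0}"]) (auto intro!: exI[of _ "{s}"])
  next
    case False
    then show ?thesis using * C by blast
  qed
qed

text \<open>Shifting \<open>Q\<close> by one of its elements \<open>h\<close> lowers the number of nonzero linear maps in
  \<open>Q\<close> if \<open>h\<close> is linear. Otherwise it creates linear maps, but lowers the number of nonzero
  quadratic parts.\<close>

theorem poly_HJ:
  fixes Q :: "((nat \<Rightarrow> nat \<Rightarrow> 'g::ab_group_add) \<times> (nat \<Rightarrow> 'g)) set"
  assumes "finite Q"
  shows "poly_HJ Q"
  using assms
proof (induction Q rule: wf_induct_rule[OF wf_measures[of
    "[\<lambda>Q. card (fst ` Q - {\<lambda>_ _. 0}), \<lambda>Q. card ({l. (\<lambda>_ _. 0, l) \<in> Q} - {\<lambda>_. 0})]"]])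
  case (1 Q)
  let ?z = "(\<lambda>_ _. 0, \<lambda>_. 0) :: (nat \<Rightarrow> nat \<Rightarrow> 'g) \<times> (nat \<Rightarrow> 'g)"
  \<comment> \<open>The zero map satisfies the claim trivially. Kept in \<open>Q\<close>, it would
    be shifted to \<open>- h\<close>, a new nonzero map, and the measure could fail to drop.\<close>
  define Q0 where "Q0 = Q - {?z}"
  have finQ0: "finite Q0" using 1 unfolding Q0_def by simp
  have finl: "finite ({l. (\<lambda>_ _. 0, l) \<in> Q})"
  proof (rule finite_subset[of _ "snd ` Q"])
    show "{l. (\<lambda>_ _. 0, l) \<in> Q} \<subseteq> snd ` Q" by force
  qed (use 1 in simp)
  have "poly_HJ Q0"
  proof (cases "\<exists>l. (\<lambda>_ _. 0, l) \<in> Q0")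
    case True
    then obtain l0 where l0: "(\<lambda>_ _. 0, l0) \<in> Q0" by blast
    show ?thesis
    proof (rule poly_HJ_of_shift[OF finQ0, of "(\<lambda>_ _. 0, l0)"])
      fix D :: "nat set" assume D: "finite D"
      let ?Q' = "\<Union>q\<in>Q0. quad_shift (\<lambda>_ _. 0, l0) q ` Pow D"
      show "poly_HJ ?Q'"
      proof (rule 1(1))
        show "finite ?Q'" using finQ0 D by simp
        \<comment> \<open>Subtracting a linear map leaves the quadratic parts alone. The linear
          parts of maps with nonzero quadratic part do change, but the measure does not count
          them.\<close>
        have "fst ` ?Q' - {\<lambda>_ _. 0} = fst ` Q - {\<lambda>_ _. 0}"
          unfolding quad_shift_def Q0_def by (auto simp: image_iff) force+
        moreover have "{l. (\<lambda>_ _. 0, l) \<in> ?Q'} - {\<lambda>_. 0} \<subseteq>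
            (\<lambda>l j. l j - l0 j) ` ({l. (\<lambda>_ _. 0, l) \<in> Q} - {\<lambda>_. 0} - {l0})"
        proof
          fix l assume "l \<in> {l. (\<lambda>_ _. 0, l) \<in> ?Q'} - {\<lambda>_. 0}"
          then obtain A l' E where *: "(A, l') \<in> Q0" "(\<lambda>_ _. 0, l) = quad_shift (\<lambda>_ _. 0, l0) (A, l') E" "l \<noteq> (\<lambda>_. 0)"
            by auto
          then have A: "A = (\<lambda>_ _. 0)" and l: "l = (\<lambda>j. l' j - l0 j)"
            unfolding quad_shift_def by (auto simp: fun_eq_iff)
          have "l' \<noteq> l0" using *(3) l by auto
          then show "l \<in> (\<lambda>l j. l j - l0 j) ` ({l. (\<lambda>_ _. 0, l) \<in> Q} - {\<lambda>_. 0} - {l0})"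
            using * A l unfolding Q0_def by auto
        qed
        then have "card ({l. (\<lambda>_ _. 0, l) \<in> ?Q'} - {\<lambda>_. 0}) \<le> card ({l. (\<lambda>_ _. 0, l) \<in> Q} - {\<lambda>_. 0} - {l0})"
          using finl by (meson card_image_le card_mono finite_Diff finite_imageI le_trans)
        moreover have "\<dots> < card ({l. (\<lambda>_ _. 0, l) \<in> Q} - {\<lambda>_. 0})"
          by (rule card_Diff1_less) (use finl l0 in \<open>auto simp: Q0_def\<close>)
        ultimately show "(?Q', Q) \<in> measures
          [\<lambda>Q. card (fst ` Q - {\<lambda>_ _. 0}), \<lambda>Q. card ({l. (\<lambda>_ _. 0, l) \<in> Q} - {\<lambda>_. 0})]" by simp
      qed
    qed
  next
    case nolin: False
    show ?thesis
    proof (cases "Q0 = {}")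
      case True
      show ?thesis unfolding poly_HJ_def True
      proof (intro allI)
        fix r s :: nat
        show "\<exists>N C. finite C \<and> (\<forall>col::'g \<Rightarrow> nat. (\<forall>g. col g < r) \<longrightarrow>
          (\<exists>z\<in>C. \<exists>B\<subseteq>{s..<N}. B \<noteq> {} \<and> (\<forall>q\<in>{}. col (z + quad_eval q B) = col z)))"
          by (intro exI[of _ "Suc s"] exI[of _ "{0}"]) (auto intro!: exI[of _ "{s}"])
      qed
    next
      case False
      then obtain A0 l0 where h: "(A0, l0) \<in> Q0" by auto
      have A0: "A0 \<noteq> (\<lambda>_ _. 0)" using nolin h by blast
      show ?thesis
      proof (rule poly_HJ_of_shift[OF finQ0, of "(A0, l0)"])
        fix D :: "nat set" assume D: "finite D"
        let ?Q' = "\<Union>q\<in>Q0. quad_shift (A0, l0) q ` Pow D"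
        show "poly_HJ ?Q'"
        proof (rule 1(1))
          show "finite ?Q'" using finQ0 D by simp
          have "fst ` ?Q' - {\<lambda>_ _. 0} \<subseteq> (\<lambda>A i j. A i j - A0 i j) ` (fst ` Q - {\<lambda>_ _. 0} - {A0})"
          proof
            fix A assume "A \<in> fst ` ?Q' - {\<lambda>_ _. 0}"
            then obtain A' l' E where *: "(A', l') \<in> Q0" "A = fst (quad_shift (A0, l0) (A', l') E)" "A \<noteq> (\<lambda>_ _. 0)"
              by auto
            then have l: "A = (\<lambda>i j. A' i j - A0 i j)"
              unfolding quad_shift_def by (auto simp: fun_eq_iff)
            have "A' \<noteq> A0" using *(3) l by auto
            moreover have "A' \<noteq> (\<lambda>_ _. 0)" using nolin * by blast
            moreover have "A' \<in> fst ` Q" using *(1) unfolding Q0_def by (metis Diff_iff fst_conv imageI)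
            ultimately show "A \<in> (\<lambda>A i j. A i j - A0 i j) ` (fst ` Q - {\<lambda>_ _. 0} - {A0})"
              unfolding l by blast
          qed
          then have "card (fst ` ?Q' - {\<lambda>_ _. 0}) \<le> card (fst ` Q - {\<lambda>_ _. 0} - {A0})"
            using 1(2) by (meson card_image_le card_mono finite_Diff finite_imageI le_trans)
          moreover have "\<dots> < card (fst ` Q - {\<lambda>_ _. 0})"
            by (rule card_Diff1_less) (use 1(2) h A0 in \<open>force simp: Q0_def\<close>)+
          ultimately show "(?Q', Q) \<in> measures
            [\<lambda>Q. card (fst ` Q - {\<lambda>_ _. 0}), \<lambda>Q. card ({l. (\<lambda>_ _. 0, l) \<in> Q} - {\<lambda>_. 0})]" by simp
        qed
      qed
    qed
  qed
  moreover have "quad_eval ?z B = 0" for B unfolding quad_eval_def by simp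
  ultimately show ?case
  proof -
    assume z: "\<And>B. quad_eval ?z B = 0" and P: "poly_HJ Q0"
    have "(\<forall>q\<in>Q. col (z + quad_eval q B) = col z) \<longleftrightarrow> (\<forall>q\<in>Q0. col (z + quad_eval q B) = col z)"
      for col :: "'g \<Rightarrow> nat" and z B
      unfolding Q0_def using z by (metis Diff_iff add.right_neutral singletonD)
    then show "poly_HJ Q" using P unfolding poly_HJ_def by simp
  qed
qed

section \<open>Averages and multiplicative derivatives\<close>

notation symdiff (infixl "\<oplus>" 65)

lemma symdiff_assoc: "(a \<oplus> b) \<oplus> c = a \<oplus> (b \<oplus> c)"
  and symdiff_commute: "a \<oplus> b = b \<oplus> a"
  and symdiff_left_commute: "a \<oplus> (b \<oplus> c) = b \<oplus> (a \<oplus> c)"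
  unfolding symdiff_def by auto

lemmas symdiff_ac = symdiff_assoc symdiff_commute symdiff_left_commute

lemma symdiff_self [simp]: "a \<oplus> a = {}"
  and symdiff_empty [simp]: "a \<oplus> {} = a" "{} \<oplus> a = a"
  and symdiff_cancel [simp]: "a \<oplus> (a \<oplus> b) = b"
  unfolding symdiff_def by auto

lemma symdiff_cancel_right [simp]: "(a \<oplus> b) \<oplus> b = a"
  by (simp add: symdiff_assoc)

lemma symdiff_in_Pow: "a \<in> Pow I \<Longrightarrow> b \<in> Pow I \<Longrightarrow> a \<oplus> b \<in> Pow I"
  unfolding symdiff_def by auto

lemma bij_betw_symdiff: "a \<in> Pow I \<Longrightarrow> bij_betw (\<lambda>x. x \<oplus> a) (Pow I) (Pow I)"
  by (rule bij_betw_byWitness[of _ "\<lambda>x. x \<oplus> a"]) (auto simp: symdiff_def)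

definition avg :: "'a set \<Rightarrow> ('a \<Rightarrow> real) \<Rightarrow> real" where
  "avg A F = (\<Sum>x\<in>A. F x) / real (card A)"

lemma avg_cong: "(\<And>x. x \<in> A \<Longrightarrow> F x = G x) \<Longrightarrow> avg A F = avg A G"
  unfolding avg_def by (simp cong: sum.cong)

lemma avg_const: "finite A \<Longrightarrow> A \<noteq> {} \<Longrightarrow> avg A (\<lambda>_. c) = c"
  unfolding avg_def by simp

lemma avg_eq_const: "finite A \<Longrightarrow> A \<noteq> {} \<Longrightarrow> (\<And>x. x \<in> A \<Longrightarrow> F x = c) \<Longrightarrow> avg A F = c"
  using avg_cong[of A F "\<lambda>_. c"] avg_const[of A c] by simp

lemma avg_const_Pow: "finite I \<Longrightarrow> avg (Pow I) (\<lambda>_. c) = c"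
  by (rule avg_const) auto

lemma avg_singleton [simp]: "avg {a} F = F a"
  unfolding avg_def by simp

lemma avg_mono: "(\<And>x. x \<in> A \<Longrightarrow> F x \<le> G x) \<Longrightarrow> avg A F \<le> avg A G"
  unfolding avg_def by (intro divide_right_mono sum_mono) auto

lemma avg_nonneg: "(\<And>x. x \<in> A \<Longrightarrow> 0 \<le> F x) \<Longrightarrow> 0 \<le> avg A F"
  unfolding avg_def by (intro divide_nonneg_nonneg sum_nonneg) auto

lemma avg_add: "avg A (\<lambda>x. F x + G x) = avg A F + avg A G"
  unfolding avg_def by (simp add: sum.distrib add_divide_distrib)

lemma avg_diff: "avg A (\<lambda>x. F x - G x) = avg A F - avg A G"
  unfolding avg_def by (simp add: sum_subtractf diff_divide_distrib)

lemma avg_cmult: "avg A (\<lambda>x. c * F x) = c * avg A F"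
  unfolding avg_def by (simp add: sum_distrib_left)

lemma avg_cmult_right: "avg A (\<lambda>x. F x * c) = avg A F * c"
  unfolding avg_def by (simp add: sum_distrib_right)

lemma avg_swap: "avg A (\<lambda>x. avg B (F x)) = avg B (\<lambda>y. avg A (\<lambda>x. F x y))"
  unfolding avg_def by (subst sum_divide_distrib[symmetric])+ (simp add: sum.swap[of _ A B] mult.commute)

lemma avg_bij: "bij_betw h A B \<Longrightarrow> avg A (\<lambda>x. F (h x)) = avg B F"
  unfolding avg_def using sum.reindex_bij_betw[of h A B F] bij_betw_same_card[of h A B] by simp

lemma avg_Times: "avg (A \<times> B) F = avg A (\<lambda>a. avg B (\<lambda>b. F (a, b)))"
  unfolding avg_def card_cartesian_product sum.cartesian_product[where g = "\<lambda>a b. F (a, b)"]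
  by (simp add: sum_divide_distrib[symmetric] mult.commute sum.cartesian_product)

lemma avg_mult_avg: "avg A F * avg B G = avg A (\<lambda>x. avg B (\<lambda>y. F x * G y))"
  by (simp add: avg_cmult avg_cmult_right)

lemma avg_sq_le:
  assumes "finite A"
  shows "(avg A F)\<^sup>2 \<le> avg A (\<lambda>x. (F x)\<^sup>2)"
proof (cases "A = {}")
  case True
  then show ?thesis by (simp add: avg_def)
next
  case False
  then have c: "real (card A) > 0" using assms by (simp add: card_gt_0_iff)
  have "(\<Sum>x\<in>A. F x)\<^sup>2 \<le> (\<Sum>x\<in>A. (F x)\<^sup>2) * real (card A)"
    using sum_squared_le_sum_of_squares[of F A] by (simp add: mult.commute)
  then show ?thesis unfolding avg_def using c
    by (simp add: power_divide power2_eq_square divide_simps mult.commute)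
qed

lemma avg_power_le:
  assumes "finite A"
  shows "(avg A F) ^ (2 ^ k) \<le> avg A (\<lambda>x. F x ^ (2 ^ k))"
proof (induction k arbitrary: F)
  case (Suc k)
  have "(avg A F) ^ (2 ^ Suc k) = ((avg A F)\<^sup>2) ^ (2 ^ k)" by (simp add: power_mult)
  also have "\<dots> \<le> (avg A (\<lambda>x. (F x)\<^sup>2)) ^ (2 ^ k)"
    by (intro power_mono avg_sq_le assms) auto
  also have "\<dots> \<le> avg A (\<lambda>x. ((F x)\<^sup>2) ^ (2 ^ k))" by (rule Suc)
  finally show ?case by (simp add: power_mult)
qed simp

lemma abs_avg_le:
  assumes "\<And>x. x \<in> A \<Longrightarrow> \<bar>F x\<bar> \<le> c" "0 \<le> c"
  shows "\<bar>avg A F\<bar> \<le> c"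
proof (cases "finite A \<and> A \<noteq> {}")
  case True
  have "\<bar>\<Sum>x\<in>A. F x\<bar> \<le> (\<Sum>x\<in>A. c)"
    by (rule order_trans[OF sum_abs]) (intro sum_mono assms)
  then show ?thesis unfolding avg_def using True
    by (simp add: abs_divide divide_le_eq card_gt_0_iff mult.commute)
next
  case False
  then show ?thesis using assms(2) by (auto simp: avg_def)
qed

lemma avg_ge_ex:
  assumes "finite A" "A \<noteq> {}" "c \<le> avg A F"
  shows "\<exists>x\<in>A. c \<le> F x"
proof (rule ccontr)
  assume "\<not> ?thesis"
  then have "(\<Sum>x\<in>A. F x) < (\<Sum>x\<in>A. c)" by (intro sum_strict_mono assms) auto
  then have "avg A F < c" unfolding avg_def using assms
    by (simp add: divide_less_eq card_gt_0_iff mult.commute)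
  then show False using assms by simp
qed

lemma avg_sym_shift: "a \<in> Pow I \<Longrightarrow> avg (Pow I) (\<lambda>x. F (x \<oplus> a)) = avg (Pow I) F"
  using avg_bij[OF bij_betw_symdiff, of a I F] .

lemma avg_lists_Suc_snoc:
  "avg {us. length us = Suc k \<and> set us \<subseteq> A} F =
   avg {us. length us = k \<and> set us \<subseteq> A} (\<lambda>us. avg A (\<lambda>u. F (us @ [u])))"
proof -
  have "bij_betw (\<lambda>(us, u). us @ [u]) ({us. length us = k \<and> set us \<subseteq> A} \<times> A)
      {us. length us = Suc k \<and> set us \<subseteq> A}"
    by (rule bij_betw_byWitness[where f' = "\<lambda>us. (butlast us, last us)"])
      (auto dest: in_set_butlastD simp: last_in_set length_Suc_conv_rev subset_iff
        intro!: set_mp[OF _ last_in_set])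
  from avg_bij[OF this, of F] show ?thesis
    by (simp add: avg_Times case_prod_unfold)
qed

definition mult_deriv :: "'a set \<Rightarrow> ('a set \<Rightarrow> real) \<Rightarrow> 'a set \<Rightarrow> real" where
  "mult_deriv y f = (\<lambda>x. f x * f (x \<oplus> y))"

fun mult_derivs :: "'a set list \<Rightarrow> ('a set \<Rightarrow> real) \<Rightarrow> 'a set \<Rightarrow> real" where
  "mult_derivs [] f = f"
| "mult_derivs (y # ys) f = mult_derivs ys (mult_deriv y f)"

text \<open>For real \<open>f\<close> and \<open>d > 0\<close> this is the \<open>2 ^ d\<close>-th
  power of the U_d norm. The recursion starts from the mean at \<open>d = 0\<close>, which may be
  negative.\<close>

fun gowers_pow :: "'a set \<Rightarrow> nat \<Rightarrow> ('a set \<Rightarrow> real) \<Rightarrow> real" where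
  "gowers_pow I 0 f = avg (Pow I) f"
| "gowers_pow I (Suc d) f = avg (Pow I) (\<lambda>y. gowers_pow I d (mult_deriv y f))"

lemma mult_deriv_commute: "mult_deriv a (mult_deriv b f) = mult_deriv b (mult_deriv a f)"
  unfolding mult_deriv_def by (auto simp: symdiff_ac mult_ac)

lemma mult_derivs_mult_deriv: "mult_derivs ys (mult_deriv y f) = mult_deriv y (mult_derivs ys f)"
  by (induction ys arbitrary: f) (simp, metis mult_deriv_commute mult_derivs.simps(2))

lemma mult_derivs_mult_deriv_apply: "mult_derivs ys (mult_deriv y f) x = mult_derivs ys f x * mult_derivs ys f (x \<oplus> y)"
  by (simp only: mult_derivs_mult_deriv) (simp add: mult_deriv_def)

lemma mult_derivs_append: "mult_derivs (xs @ ys) f = mult_derivs ys (mult_derivs xs f)"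
  by (induction xs arbitrary: f) simp_all

lemma mult_deriv_bounded:
  assumes "\<And>x. \<bar>f x\<bar> \<le> 1"
  shows "\<bar>mult_deriv y f x\<bar> \<le> 1"
  unfolding mult_deriv_def abs_mult using assms by (simp add: mult_le_one)

lemma mult_derivs_bounded: "(\<And>x. \<bar>f x\<bar> \<le> 1) \<Longrightarrow> \<bar>mult_derivs ys f x\<bar> \<le> 1"
  by (induction ys arbitrary: f) (simp_all add: mult_deriv_bounded)

lemma gowers_pow_le_1: "(\<And>x. \<bar>f x\<bar> \<le> 1) \<Longrightarrow> \<bar>gowers_pow I d f\<bar> \<le> 1"
  by (induction d arbitrary: f) (auto intro!: abs_avg_le simp: mult_deriv_bounded)

lemma gowers_pow_cong:
  assumes "\<And>x. x \<in> Pow I \<Longrightarrow> f x = g x"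
  shows "gowers_pow I d f = gowers_pow I d g"
  using assms
proof (induction d arbitrary: f g)
  case (Suc d)
  have "gowers_pow I d (mult_deriv y f) = gowers_pow I d (mult_deriv y g)" if "y \<in> Pow I" for y
    by (rule Suc.IH) (use Suc.prems that symdiff_in_Pow[of _ I y] in \<open>auto simp: mult_deriv_def\<close>)
  then show ?case by (auto intro: avg_cong)
qed (auto intro: avg_cong)

lemma gowers_pow_1: "gowers_pow I (Suc 0) f = (avg (Pow I) f)\<^sup>2"
proof -
  have "gowers_pow I (Suc 0) f = avg (Pow I) (\<lambda>x. avg (Pow I) (\<lambda>y. f x * f (x \<oplus> y)))"
    unfolding gowers_pow.simps mult_deriv_def by (rule avg_swap)
  also have "\<dots> = avg (Pow I) (\<lambda>x. f x * avg (Pow I) (\<lambda>y. f (y \<oplus> x)))"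
    by (simp add: avg_cmult symdiff_commute)
  also have "\<dots> = avg (Pow I) (\<lambda>x. f x * avg (Pow I) f)"
    by (intro avg_cong) (simp only: avg_sym_shift)
  finally show ?thesis by (simp add: avg_cmult_right power2_eq_square)
qed

lemma gowers_pow_nonneg: "0 \<le> gowers_pow I (Suc d) f"
proof (induction d arbitrary: f)
  case 0
  then show ?case by (simp only: gowers_pow_1 zero_le_power2)
next
  case (Suc d)
  then show ?case by (subst gowers_pow.simps(2)) (intro avg_nonneg)
qed

text \<open>In the variable \<open>v\<close>, the number \<open>gowers_pow I d (mult_deriv v h)\<close> is a positive definite function whose
  mean is \<open>gowers_pow I (Suc d) h\<close>.\<close>

lemma gowers_pow_Suc_le_avg_diffs:
  assumes "finite I" "S \<subseteq> Pow I" "S \<noteq> {}"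
  shows "gowers_pow I (Suc d) h \<le> avg S (\<lambda>s. avg S (\<lambda>s'. gowers_pow I d (mult_deriv (s \<oplus> s') h)))"
proof (induction d arbitrary: h)
  case 0
  have finS: "finite S" using assms finite_subset by blast
  have "avg S (\<lambda>s. avg S (\<lambda>s'. gowers_pow I 0 (mult_deriv (s \<oplus> s') h))) =
     avg S (\<lambda>s. avg S (\<lambda>s'. avg (Pow I) (\<lambda>x. h (x \<oplus> s) * h (x \<oplus> s'))))"
  proof (intro avg_cong)
    fix s s' assume s: "s \<in> S" "s' \<in> S"
    show "gowers_pow I 0 (mult_deriv (s \<oplus> s') h) = avg (Pow I) (\<lambda>x. h (x \<oplus> s) * h (x \<oplus> s'))"
      using avg_sym_shift[of s I "mult_deriv (s \<oplus> s') h"] s assms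
      by (auto simp: mult_deriv_def symdiff_ac)
  qed
  \<comment> \<open>After translation by \<open>s\<close> the kernel is a product, so the double
    average is a mean of squares.\<close>
  also have "\<dots> = avg (Pow I) (\<lambda>x. (avg S (\<lambda>s. h (x \<oplus> s)))\<^sup>2)"
    by (simp only: avg_swap[of S "Pow I"] power2_eq_square avg_mult_avg)
  also have "\<dots> \<ge> (avg (Pow I) (\<lambda>x. avg S (\<lambda>s. h (x \<oplus> s))))\<^sup>2"
    by (rule avg_sq_le) (use assms in simp)
  finally have "(avg S (\<lambda>s. avg (Pow I) (\<lambda>x. h (x \<oplus> s))))\<^sup>2 \<le>
      avg S (\<lambda>s. avg S (\<lambda>s'. gowers_pow I 0 (mult_deriv (s \<oplus> s') h)))"
    by (subst avg_swap)
  moreover have "avg S (\<lambda>s. avg (Pow I) (\<lambda>x. h (x \<oplus> s))) = avg S (\<lambda>s. avg (Pow I) h)"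
    by (intro avg_cong avg_sym_shift) (use assms in auto)
  ultimately show ?case
    using avg_const[OF finS assms(3)] by (simp only: gowers_pow_1)
next
  case (Suc d)
  have "gowers_pow I (Suc (Suc d)) h \<le> avg (Pow I) (\<lambda>y. avg S (\<lambda>s. avg S (\<lambda>s'. gowers_pow I d (mult_deriv (s \<oplus> s') (mult_deriv y h)))))"
    by (subst gowers_pow.simps(2)) (intro avg_mono Suc.IH)
  also have "\<dots> = avg S (\<lambda>s. avg S (\<lambda>s'. gowers_pow I (Suc d) (mult_deriv (s \<oplus> s') h)))"
    by (simp only: avg_swap[of "Pow I" S] gowers_pow.simps mult_deriv_commute[of _ "_ \<oplus> _"])
  finally show ?case .
qed

section \<open>Correcting shifts\<close>

text \<open>A packing argument. Take a maximal \<open>S\<close> with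
  \<open>G (s \<oplus> s') < e / 2\<close> for distinct elements. The average of \<open>G\<close>
  over all pairs is at least \<open>e\<close>, while the diagonal contributes at most
  \<open>1 / card S\<close> and the other pairs at most \<open>e / 2\<close>. So
  \<open>card S\<close> is at most \<open>2 / e\<close>, whatever \<open>I\<close> is, and by
  maximality \<open>S\<close> contains a correction for every \<open>Y\<close>.\<close>

lemma gowers_pow_reference_set:
  assumes "finite I" and f: "\<And>x. \<bar>h x\<bar> \<le> 1" and e: "0 < e" "e \<le> gowers_pow I (Suc d) h" and R: "2 / e \<le> real R"
  shows "\<exists>\<sigma>::nat \<Rightarrow> 'a set. (\<forall>l. \<sigma> l \<in> Pow I) \<and> (\<forall>Y\<in>Pow I. \<exists>l<R. e / 2 \<le> gowers_pow I d (mult_deriv (Y \<oplus> \<sigma> l) h))"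
proof -
  define G where "G v = gowers_pow I d (mult_deriv v h)" for v
  define P where "P S \<longleftrightarrow> S \<subseteq> Pow I \<and> (\<forall>s\<in>S. \<forall>s'\<in>S. s \<noteq> s' \<longrightarrow> G (s \<oplus> s') < e / 2)" for S
  have "finite {S. P S}"
    by (rule finite_subset[of _ "Pow (Pow I)"]) (use assms in \<open>auto simp: P_def\<close>)
  moreover have "P {}" unfolding P_def by simp
  ultimately obtain S where S: "P S" and max: "\<And>S'. P S' \<Longrightarrow> S \<subseteq> S' \<Longrightarrow> S = S'"
    using finite_has_maximal[of "{S. P S}"] by blast
  have "S \<noteq> {}"
  proof
    assume "S = {}"
    then show False using max[of "{{}}"] unfolding P_def by simp
  qed
  have finS: "finite S" using S assms(1) finite_subset[of S "Pow I"] unfolding P_def by simp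
  have G1: "G v \<le> 1" for v
  proof -
    have "\<bar>gowers_pow I d (mult_deriv v h)\<bar> \<le> 1" by (intro gowers_pow_le_1 mult_deriv_bounded f)
    then show ?thesis unfolding G_def by simp
  qed
  have e': "e \<le> avg T (\<lambda>s. avg T (\<lambda>s'. G (s \<oplus> s')))" if "T \<subseteq> Pow I" "T \<noteq> {}" for T
    unfolding G_def using gowers_pow_Suc_le_avg_diffs[OF assms(1) that, of d h] e(2) by simp
  have c: "real (card S) > 0" using finS \<open>S \<noteq> {}\<close> by (simp add: card_gt_0_iff)
  have "avg S (\<lambda>s'. G (s \<oplus> s')) \<le> 1 / real (card S) + e / 2" if s: "s \<in> S" for s
  proof -
    have "(\<Sum>s'\<in>S. G (s \<oplus> s')) = G (s \<oplus> s) + (\<Sum>s'\<in>S - {s}. G (s \<oplus> s'))"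
      using sum.remove[OF finS s] .
    also have "\<dots> \<le> 1 + (\<Sum>s'\<in>S - {s}. e / 2)"
      by (intro add_mono G1 sum_mono less_imp_le) (use S s in \<open>auto simp: P_def\<close>)
    also have "\<dots> \<le> 1 + (\<Sum>s'\<in>S. e / 2)"
      by (intro add_left_mono sum_mono2 finS) (use e in auto)
    finally show ?thesis unfolding avg_def using c by (simp add: field_simps)
  qed
  then have "avg S (\<lambda>s. avg S (\<lambda>s'. G (s \<oplus> s'))) \<le> avg S (\<lambda>s. 1 / real (card S) + e / 2)"
    by (intro avg_mono)
  also have "\<dots> = 1 / real (card S) + e / 2" using finS \<open>S \<noteq> {}\<close> by (rule avg_const)
  finally have "e / 2 \<le> 1 / real (card S)" using e'[of S] S \<open>S \<noteq> {}\<close> unfolding P_def by simp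
  then have "real (card S) \<le> 2 / e" using c e by (simp add: field_simps)
  then have cR: "card S \<le> R" using R by linarith
  obtain b where b: "bij_betw b {0..<card S} S" using ex_bij_betw_nat_finite[OF finS] by blast
  \<comment> \<open>Spare labels stand for the zero shift, so the same \<open>R\<close> labels serve
    every function.\<close>
  define \<sigma> where "\<sigma> l = (if l < card S then b l else {})" for l
  have "\<exists>s\<in>S. e / 2 \<le> G (Y \<oplus> s)" if Y: "Y \<in> Pow I" for Y
  proof (cases "Y \<in> S")
    case True
    \<comment> \<open>The averaging bound for the one-element set \<open>{{}}\<close>. It makes each
      element of \<open>S\<close> its own correction.\<close>
    have "e \<le> G {}" using e'[of "{{}}"] by (simp add: avg_def)
    then show ?thesis using True e by (intro bexI[of _ Y]) auto
  next
    case False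
    show ?thesis
    proof (rule ccontr)
      assume "\<not> ?thesis"
      then have lt: "G (Y \<oplus> s) < e / 2" if "s \<in> S" for s using that by force
      have "G (s \<oplus> s') < e / 2" if s: "s \<in> insert Y S" "s' \<in> insert Y S" "s \<noteq> s'" for s s'
      proof (cases "s = Y \<or> s' = Y")
        case True
        have "G (s \<oplus> s') = G (s' \<oplus> s)" by (simp add: symdiff_commute)
        then show ?thesis using s True lt[of s] lt[of s'] by auto
      next
        case False
        then show ?thesis using s S unfolding P_def by simp
      qed
      then have "P (insert Y S)" using S Y unfolding P_def by simp
      then show False using max[of "insert Y S"] False by blast
    qed
  qed
  note cover = this
  have onto: "\<exists>l<R. \<sigma> l = s" if "s \<in> S" for s
  proof -
    have "s \<in> b ` {0..<card S}" using bij_betw_imp_surj_on[OF b] that by simp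
    then obtain l where "l < card S" "b l = s" by auto
    then show ?thesis using cR unfolding \<sigma>_def by (intro exI[of _ l]) simp
  qed
  have "\<exists>l<R. e / 2 \<le> gowers_pow I d (mult_deriv (Y \<oplus> \<sigma> l) h)" if "Y \<in> Pow I" for Y
    using cover[OF that] onto unfolding G_def by blast
  moreover have "\<sigma> l \<in> Pow I" for l
  proof (cases "l < card S")
    case True
    then have "b l \<in> S" using bij_betwE[OF b] by simp
    then show ?thesis using S True unfolding \<sigma>_def P_def by auto
  qed (simp add: \<sigma>_def)
  ultimately show ?thesis by blast
qed

text \<open>The choice depends on \<open>h\<close> but not on the shift to be corrected, which is
  why later corrections are functions of earlier shifts and of labels. Membership in
  \<open>Pow I\<close> is unconditional because \<open>corrected\<close> is run with arbitrary
  labels, for which the norm of \<open>h\<close> may be small.\<close>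

definition reference_shifts :: "'a set \<Rightarrow> nat \<Rightarrow> real \<Rightarrow> nat \<Rightarrow> ('a set \<Rightarrow> real) \<Rightarrow> nat \<Rightarrow> 'a set" where
  "reference_shifts I R e d h = (SOME \<sigma>. (\<forall>l. \<sigma> l \<in> Pow I) \<and>
     ((\<forall>x. \<bar>h x\<bar> \<le> 1) \<and> 0 < e \<and> e \<le> gowers_pow I (Suc d) h \<and> 2 / e \<le> real R \<longrightarrow>
       (\<forall>Y\<in>Pow I. \<exists>l<R. e / 2 \<le> gowers_pow I d (mult_deriv (Y \<oplus> \<sigma> l) h))))"

lemma reference_shifts:
  assumes "finite I"
  shows "reference_shifts I R e d h l \<in> Pow I"
    and "(\<And>x. \<bar>h x\<bar> \<le> 1) \<Longrightarrow> 0 < e \<Longrightarrow> e \<le> gowers_pow I (Suc d) h \<Longrightarrow> 2 / e \<le> real R \<Longrightarrow> Y \<in> Pow I \<Longrightarrow>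
      \<exists>l<R. e / 2 \<le> gowers_pow I d (mult_deriv (Y \<oplus> reference_shifts I R e d h l) h)"
proof -
  let ?P = "\<lambda>\<sigma>::nat \<Rightarrow> 'a set. (\<forall>l. \<sigma> l \<in> Pow I) \<and>
     ((\<forall>x. \<bar>h x\<bar> \<le> 1) \<and> 0 < e \<and> e \<le> gowers_pow I (Suc d) h \<and> 2 / e \<le> real R \<longrightarrow>
       (\<forall>Y\<in>Pow I. \<exists>l<R. e / 2 \<le> gowers_pow I d (mult_deriv (Y \<oplus> \<sigma> l) h)))"
  have "\<exists>\<sigma>. ?P \<sigma>"
  proof (cases "(\<forall>x. \<bar>h x\<bar> \<le> 1) \<and> 0 < e \<and> e \<le> gowers_pow I (Suc d) h \<and> 2 / e \<le> real R")
    case True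
    then show ?thesis using gowers_pow_reference_set[OF assms, of h e d R] by blast
  next
    case False
    then show ?thesis by (intro exI[of _ "\<lambda>_. {}"]) auto
  qed
  then have "?P (reference_shifts I R e d h)" unfolding reference_shifts_def by (rule someI_ex)
  then show "reference_shifts I R e d h l \<in> Pow I"
    and "(\<And>x. \<bar>h x\<bar> \<le> 1) \<Longrightarrow> 0 < e \<Longrightarrow> e \<le> gowers_pow I (Suc d) h \<Longrightarrow> 2 / e \<le> real R \<Longrightarrow> Y \<in> Pow I \<Longrightarrow>
      \<exists>l<R. e / 2 \<le> gowers_pow I d (mult_deriv (Y \<oplus> reference_shifts I R e d h l) h)" by blast+
qed

text \<open>Labels are an input rather than chosen on the way. For fixed labels the map is
  triangular, hence injective, and the labels that suit a tuple can be used as its colour.\<close>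

fun corrected :: "'a set \<Rightarrow> nat \<Rightarrow> real \<Rightarrow> ('a set \<Rightarrow> real) \<Rightarrow> 'a set list \<Rightarrow> nat list \<Rightarrow> 'a set list" where
  "corrected I R e f (v # vs) (l # ls) =
     (v \<oplus> reference_shifts I R e (Suc (length vs)) f l) #
       corrected I R (e / 2) (mult_deriv (v \<oplus> reference_shifts I R e (Suc (length vs)) f l) f) vs ls"
| "corrected I R e f _ _ = []"

text \<open>Recomputes from the prefix alone what \<open>corrected\<close> adds to the next entry,
  which makes the dependence on earlier entries explicit.\<close>

fun correction :: "'a set \<Rightarrow> nat \<Rightarrow> real \<Rightarrow> nat \<Rightarrow> ('a set \<Rightarrow> real) \<Rightarrow> nat list \<Rightarrow> 'a set list \<Rightarrow> 'a set" where
  "correction I R e k f (l # ls) [] = reference_shifts I R e k f l"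
| "correction I R e k f (l # ls) (v # p) =
     correction I R (e / 2) (k - 1) (mult_deriv (v \<oplus> reference_shifts I R e k f l) f) ls p"
| "correction I R e k f [] _ = {}"

lemma length_corrected: "length ls = length vs \<Longrightarrow> length (corrected I R e f vs ls) = length vs"
  by (induction I R e f vs ls rule: corrected.induct) auto

lemma corrected_nth:
  "length ls = length vs \<Longrightarrow> i < length vs \<Longrightarrow>
    corrected I R e f vs ls ! i = vs ! i \<oplus> correction I R e (length vs) f ls (take i vs)"
proof (induction I R e f vs ls arbitrary: i rule: corrected.induct)
  case (1 I R e f v vs l ls)
  then show ?case by (cases i) auto
qed auto

lemma corrected_in_Pow:
  "finite I \<Longrightarrow> set vs \<subseteq> Pow I \<Longrightarrow> set (corrected I R e f vs ls) \<subseteq> Pow I"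
proof (induction I R e f vs ls rule: corrected.induct)
  case (1 I R e f v vs l ls)
  then show ?case using symdiff_in_Pow[of v I] reference_shifts(1)[of I] by auto
qed auto

lemma corrected_inj:
  "length ls = length vs \<Longrightarrow> length ls = length ws \<Longrightarrow>
    corrected I R e f vs ls = corrected I R e f ws ls \<Longrightarrow> vs = ws"
proof (induction ls arbitrary: vs ws e f)
  case (Cons l ls)
  obtain v vs' w ws' where *: "vs = v # vs'" "ws = w # ws'"
    using Cons.prems by (metis length_Suc_conv)
  have len: "length vs' = length ws'" using Cons.prems * by simp
  then have "v \<oplus> reference_shifts I R e (Suc (length ws')) f l = w \<oplus> reference_shifts I R e (Suc (length ws')) f l"
    using Cons.prems(3) * by simp
  then have "v = w" by (metis symdiff_cancel_right)
  moreover have "vs' = ws'"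
    by (rule Cons.IH) (use Cons.prems * len \<open>v = w\<close> in auto)
  ultimately show ?case using * by simp
qed simp

text \<open>Each entry lowers the degree by one at the price of halving the bound, until U_1 yields
  a squared mean. The condition on \<open>R\<close> reproduces itself, since the length drops by one
  while \<open>e\<close> halves.\<close>

lemma corrected_large:
  assumes "finite I" "\<And>x. \<bar>f x\<bar> \<le> 1" "0 < e" "e \<le> gowers_pow I (Suc (length vs)) f"
    "2 ^ Suc (length vs) / e \<le> real R" "set vs \<subseteq> Pow I"
  shows "\<exists>ls. length ls = length vs \<and> set ls \<subseteq> {..<R} \<and>
    e / 2 ^ length vs \<le> (avg (Pow I) (mult_derivs (corrected I R e f vs ls) f))\<^sup>2"
  using assms(2-)
proof (induction vs arbitrary: e f)
  case Nil
  then show ?case using gowers_pow_1[of I f] by simp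
next
  case (Cons v vs)
  have "2 / e \<le> 2 ^ Suc (length (v # vs)) / e"
    using Cons.prems(2) one_le_power[of "2::real" "Suc (length vs)"] by (intro divide_right_mono) simp_all
  then have "2 / e \<le> real R" using Cons.prems by linarith
  then obtain l where l: "l < R" "e / 2 \<le> gowers_pow I (Suc (length vs)) (mult_deriv (v \<oplus> reference_shifts I R e (Suc (length vs)) f l) f)"
    using reference_shifts(2)[OF assms(1), of f e "Suc (length vs)" R v] Cons.prems by auto
  define g where "g = mult_deriv (v \<oplus> reference_shifts I R e (Suc (length vs)) f l) f"
  have "\<exists>ls. length ls = length vs \<and> set ls \<subseteq> {..<R} \<and>
    e / 2 / 2 ^ length vs \<le> (avg (Pow I) (mult_derivs (corrected I R (e / 2) g vs ls) g))\<^sup>2"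
    by (rule Cons.IH) (use Cons.prems l in \<open>auto simp: g_def field_simps intro!: mult_deriv_bounded\<close>)
  then obtain ls where "length ls = length vs" "set ls \<subseteq> {..<R}"
    "e / 2 / 2 ^ length vs \<le> (avg (Pow I) (mult_derivs (corrected I R (e / 2) g vs ls) g))\<^sup>2" by blast
  then show ?case using l(1) unfolding g_def by (intro exI[of _ "l # ls"]) simp
qed

section \<open>Conditioning on blocks of coordinates\<close>

text \<open>Conditional expectation given the coordinates in \<open>E\<close>. On
  \<open>Pow I\<close> it depends only on \<open>p \<inter> E\<close>; admitting such
  \<open>p\<close> lets it be averaged over the whole cube.\<close>

definition cond_avg :: "'a set \<Rightarrow> 'a set \<Rightarrow> ('a set \<Rightarrow> real) \<Rightarrow> 'a set \<Rightarrow> real" where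
  "cond_avg I E F p = avg (Pow (I - E)) (\<lambda>x. F (p \<oplus> x))"

definition cond_var :: "'a set \<Rightarrow> 'a set \<Rightarrow> ('a set \<Rightarrow> real) \<Rightarrow> real" where
  "cond_var I E F = avg (Pow I) (\<lambda>X. (cond_avg I E F X - avg (Pow I) F)\<^sup>2)"

lemma avg_Pow_split:
  assumes "E \<subseteq> I"
  shows "avg (Pow I) F = avg (Pow E) (\<lambda>p. avg (Pow (I - E)) (\<lambda>x. F (p \<oplus> x)))"
proof -
  have "bij_betw (\<lambda>(p, x). p \<oplus> x) (Pow E \<times> Pow (I - E)) (Pow I)"
    by (rule bij_betw_byWitness[where f' = "\<lambda>X. (X \<inter> E, X - E)"])
      (use assms in \<open>auto simp: symdiff_def\<close>)
  from avg_bij[OF this, of F] show ?thesis by (simp add: avg_Times case_prod_unfold)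
qed

text \<open>Averaging out the coordinates outside \<open>E'\<close> is a self-adjoint operation, so
  it can be moved to the other factor.\<close>

lemma avg_cond_avg_cond_avg:
  assumes "E \<subseteq> I" "E' \<subseteq> I"
  shows "avg (Pow I) (\<lambda>X. cond_avg I E F X * cond_avg I E' F X) =
    avg (Pow I) (\<lambda>X. F X * avg (Pow (I - E')) (\<lambda>x'. cond_avg I E F (X \<oplus> x')))"
proof -
  have "avg (Pow I) (\<lambda>X. cond_avg I E F X * cond_avg I E' F X) =
     avg (Pow (I - E')) (\<lambda>x'. avg (Pow I) (\<lambda>X. cond_avg I E F X * F (X \<oplus> x')))"
    unfolding cond_avg_def[of I E'] avg_cmult[symmetric] by (rule avg_swap)
  also have "\<dots> = avg (Pow (I - E')) (\<lambda>x'. avg (Pow I) (\<lambda>X. F X * cond_avg I E F (X \<oplus> x')))"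
  proof (rule avg_cong)
    fix x' assume "x' \<in> Pow (I - E')"
    then have "x' \<in> Pow I" by auto
    from avg_sym_shift[OF this, of "\<lambda>X. F X * cond_avg I E F (X \<oplus> x')"]
    show "avg (Pow I) (\<lambda>X. cond_avg I E F X * F (X \<oplus> x')) = avg (Pow I) (\<lambda>X. F X * cond_avg I E F (X \<oplus> x'))"
      by (simp add: mult.commute)
  qed
  also have "\<dots> = avg (Pow I) (\<lambda>X. F X * avg (Pow (I - E')) (\<lambda>x'. cond_avg I E F (X \<oplus> x')))"
    unfolding avg_cmult[symmetric] by (rule avg_swap)
  finally show ?thesis .
qed

lemma cond_avg_shift: "x \<in> Pow (I - E) \<Longrightarrow> cond_avg I E F (X \<oplus> x) = cond_avg I E F X"
  unfolding cond_avg_def using avg_sym_shift[of x "I - E" "\<lambda>y. F (X \<oplus> y)"]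
  by (simp add: symdiff_ac)

text \<open>The inner conditional expectation sees only the coordinates in \<open>E\<close>, and all
  of these lie outside \<open>E'\<close> and are averaged out.\<close>

lemma avg_cond_avg_other:
  assumes "finite I" "E \<subseteq> I" "E' \<subseteq> I" "E \<inter> E' = {}" "X \<in> Pow I"
  shows "avg (Pow (I - E')) (\<lambda>x'. cond_avg I E F (X \<oplus> x')) = avg (Pow I) F"
proof -
  have "avg (Pow (I - E')) (\<lambda>x'. cond_avg I E F (X \<oplus> x')) =
      avg (Pow E) (\<lambda>p. avg (Pow (I - E' - E)) (\<lambda>b. cond_avg I E F (X \<oplus> (p \<oplus> b))))"
    using assms by (intro avg_Pow_split) auto
  also have "\<dots> = avg (Pow E) (\<lambda>p. avg (Pow (I - E' - E)) (\<lambda>b. cond_avg I E F (X \<oplus> p)))"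
    by (intro avg_cong) (simp add: symdiff_assoc[symmetric], rule cond_avg_shift, auto)
  also have "\<dots> = avg (Pow E) (\<lambda>p. cond_avg I E F (X \<oplus> p))"
    using assms(1) by (intro avg_cong avg_const) auto
  also have "\<dots> = avg (Pow I) (\<lambda>Z. F (X \<oplus> Z))"
    unfolding cond_avg_def by (subst avg_Pow_split[OF assms(2)]) (simp add: symdiff_assoc)
  also have "\<dots> = avg (Pow I) F"
    using avg_sym_shift[OF assms(5), of F] by (simp add: symdiff_commute)
  finally show ?thesis .
qed

lemma avg_cond_avg:
  assumes "finite I"
  shows "avg (Pow I) (cond_avg I E F) = avg (Pow I) F"
proof -
  have "avg (Pow I) (cond_avg I E F) = avg (Pow (I - E)) (\<lambda>x. avg (Pow I) (\<lambda>X. F (X \<oplus> x)))"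
    unfolding cond_avg_def by (rule avg_swap)
  also have "\<dots> = avg (Pow (I - E)) (\<lambda>x. avg (Pow I) F)"
    by (intro avg_cong avg_sym_shift) auto
  also have "\<dots> = avg (Pow I) F" using assms by (intro avg_const) auto
  finally show ?thesis .
qed

lemma sum_avg: "(\<Sum>j\<in>J. avg A (F j)) = avg A (\<lambda>x. \<Sum>j\<in>J. F j x)"
  unfolding avg_def by (simp add: sum_divide_distrib[symmetric] sum.swap[of _ J A])

text \<open>The centred conditional expectations on disjoint blocks of coordinates are orthogonal, so this is
  Bessel's inequality.\<close>

lemma sum_cond_var_le_1:
  fixes E :: "'j \<Rightarrow> 'a set"
  assumes fin: "finite I" "finite J" and E: "\<And>j. j \<in> J \<Longrightarrow> E j \<subseteq> I"
    and disj: "\<And>i j. i \<in> J \<Longrightarrow> j \<in> J \<Longrightarrow> i \<noteq> j \<Longrightarrow> E i \<inter> E j = {}"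
    and F: "\<And>x. \<bar>F x\<bar> \<le> 1"
  shows "(\<Sum>j\<in>J. cond_var I (E j) F) \<le> 1"
proof -
  define m where "m = avg (Pow I) F"
  define g where "g j X = cond_avg I (E j) F X - m" for j X
  have P: "finite (Pow I)" "Pow I \<noteq> {}" using fin by auto
  have gg: "avg (Pow I) (\<lambda>X. g i X * g j X) = avg (Pow I) (\<lambda>X. cond_avg I (E i) F X * cond_avg I (E j) F X) - m\<^sup>2" for i j
  proof -
    have "avg (Pow I) (\<lambda>X. g i X * g j X) = avg (Pow I) (\<lambda>X. cond_avg I (E i) F X * cond_avg I (E j) F X
        - (m * cond_avg I (E i) F X + (m * cond_avg I (E j) F X - m\<^sup>2)))"
      by (rule avg_cong) (simp add: g_def algebra_simps power2_eq_square)
    also have "\<dots> = avg (Pow I) (\<lambda>X. cond_avg I (E i) F X * cond_avg I (E j) F X) - (m * m + (m * m - m\<^sup>2))"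
      by (simp only: avg_diff avg_add avg_cmult avg_const[OF P] avg_cond_avg[OF fin(1)] m_def)
    finally show ?thesis by (simp add: power2_eq_square)
  qed
  have ortho: "avg (Pow I) (\<lambda>X. g i X * g j X) = 0" if "i \<in> J" "j \<in> J" "i \<noteq> j" for i j
  proof -
    have "avg (Pow I) (\<lambda>X. cond_avg I (E i) F X * cond_avg I (E j) F X) = avg (Pow I) (\<lambda>X. F X * m)"
      unfolding avg_cond_avg_cond_avg[OF E[OF that(1)] E[OF that(2)]]
      by (intro avg_cong) (simp add: avg_cond_avg_other[OF fin(1) E[OF that(1)] E[OF that(2)] disj[OF that]] m_def)
    then show ?thesis unfolding gg by (simp add: avg_cmult_right m_def power2_eq_square)
  qed
  have Fg: "avg (Pow I) (\<lambda>X. F X * g j X) = cond_var I (E j) F" if "j \<in> J" for j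
  proof -
    have "cond_var I (E j) F = avg (Pow I) (\<lambda>X. g j X * g j X)"
      unfolding cond_var_def g_def m_def by (simp add: power2_eq_square)
    also have "\<dots> = avg (Pow I) (\<lambda>X. F X * cond_avg I (E j) F X) - m\<^sup>2"
    proof -
      have "avg (Pow (I - E j)) (\<lambda>x'. cond_avg I (E j) F (X \<oplus> x')) = cond_avg I (E j) F X" for X
        using fin(1) by (intro avg_eq_const) (auto simp: cond_avg_shift)
      then show ?thesis unfolding gg avg_cond_avg_cond_avg[OF E[OF that] E[OF that]] by simp
    qed
    also have "\<dots> = avg (Pow I) (\<lambda>X. F X * g j X)"
      unfolding g_def right_diff_distrib avg_diff avg_cmult_right by (simp add: m_def power2_eq_square)
    finally show ?thesis ..
  qed
  \<comment> \<open>\<open>T\<close> is both the inner product of \<open>F\<close> with the sum of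
    the \<open>g j\<close> and the squared norm of that sum, so Cauchy-Schwarz gives
    \<open>T\<^sup>2 \<le> T\<close>.\<close>
  define T where "T = (\<Sum>j\<in>J. cond_var I (E j) F)"
  have T1: "T = avg (Pow I) (\<lambda>X. F X * (\<Sum>j\<in>J. g j X))"
    unfolding T_def sum_distrib_left sum_avg[symmetric] using Fg by simp
  have T2: "T = avg (Pow I) (\<lambda>X. (\<Sum>j\<in>J. g j X)\<^sup>2)"
  proof -
    have "avg (Pow I) (\<lambda>X. (\<Sum>j\<in>J. g j X)\<^sup>2) = (\<Sum>i\<in>J. \<Sum>j\<in>J. avg (Pow I) (\<lambda>X. g i X * g j X))"
      unfolding power2_eq_square sum_product sum_avg ..
    also have "\<dots> = (\<Sum>i\<in>J. \<Sum>j\<in>J. if j = i then avg (Pow I) (\<lambda>X. g i X * g i X) else 0)"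
      by (intro sum.cong refl) (auto simp: ortho)
    also have "\<dots> = (\<Sum>i\<in>J. avg (Pow I) (\<lambda>X. g i X * g i X))"
      using fin(2) by simp
    finally show ?thesis unfolding T_def cond_var_def g_def m_def by (simp add: power2_eq_square)
  qed
  have "T\<^sup>2 \<le> avg (Pow I) (\<lambda>X. (F X * (\<Sum>j\<in>J. g j X))\<^sup>2)"
    unfolding T1 by (rule avg_sq_le[OF P(1)])
  also have "\<dots> \<le> T" unfolding T2
  proof (rule avg_mono)
    fix X
    have "(F X)\<^sup>2 \<le> 1" using F[of X] by (simp add: abs_square_le_1)
    then show "(F X * (\<Sum>j\<in>J. g j X))\<^sup>2 \<le> (\<Sum>j\<in>J. g j X)\<^sup>2"
      by (simp add: power_mult_distrib mult_left_le_one_le)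
  qed
  finally have "T * T \<le> T * 1" by (simp add: power2_eq_square)
  then have "T \<le> 1"
    using mult_strict_left_mono[of 1 T T] by fastforce
  then show ?thesis unfolding T_def .
qed

text \<open>\<open>cond_var\<close> is the mean of these squares over the \<open>2 ^ card E\<close>
  points of the block, so a single one exceeds it at most by that factor. The loss is affordable
  because the block size is fixed before the number of blocks.\<close>

lemma cond_avg_deviation_le:
  assumes "finite I" "E \<subseteq> I" "p \<in> Pow E"
  shows "(cond_avg I E F p - avg (Pow I) F)\<^sup>2 \<le> 2 ^ card E * cond_var I E F"
proof -
  have finE: "finite E" using assms finite_subset by blast
  have "cond_var I E F = avg (Pow E) (\<lambda>p. avg (Pow (I - E)) (\<lambda>x. (cond_avg I E F (p \<oplus> x) - avg (Pow I) F)\<^sup>2))"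
    unfolding cond_var_def by (rule avg_Pow_split[OF assms(2)])
  also have "\<dots> = avg (Pow E) (\<lambda>p. (cond_avg I E F p - avg (Pow I) F)\<^sup>2)"
    using assms(1) by (intro avg_cong avg_eq_const) (auto simp: cond_avg_shift)
  also have "\<dots> = (\<Sum>p\<in>Pow E. (cond_avg I E F p - avg (Pow I) F)\<^sup>2) / 2 ^ card E"
    unfolding avg_def using finE by (simp add: card_Pow)
  finally have "2 ^ card E * cond_var I E F = (\<Sum>p\<in>Pow E. (cond_avg I E F p - avg (Pow I) F)\<^sup>2)" by simp
  moreover have "(cond_avg I E F p - avg (Pow I) F)\<^sup>2 \<le> (\<Sum>p\<in>Pow E. (cond_avg I E F p - avg (Pow I) F)\<^sup>2)"
    using finE assms(3) by (intro member_le_sum) auto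
  ultimately show ?thesis by simp
qed

lemma cond_var_nonneg: "0 \<le> cond_var I E F"
  unfolding cond_var_def by (intro avg_nonneg) simp

section \<open>Planting a structure in a block\<close>

definition lists_of :: "nat \<Rightarrow> 'a set \<Rightarrow> 'a list set" where
  "lists_of k A = {us. length us = k \<and> set us \<subseteq> A}"

lemma finite_lists_of: "finite A \<Longrightarrow> finite (lists_of k A)"
  unfolding lists_of_def using finite_lists_length_eq[of A k] by (simp add: conj_commute)

lemma card_lists_of: "finite A \<Longrightarrow> card (lists_of k A) = card A ^ k"
  unfolding lists_of_def using card_lists_length_eq[of A k] by (simp add: conj_commute)

lemma lists_of_nonempty: "a \<in> A \<Longrightarrow> lists_of k A \<noteq> {}"
  unfolding lists_of_def by (auto intro!: exI[of _ "replicate k a"])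

lemma lists_of_0: "lists_of 0 A = {[]}"
  unfolding lists_of_def by auto

lemma lists_of_mono: "xs \<in> lists_of k A \<Longrightarrow> A \<subseteq> B \<Longrightarrow> xs \<in> lists_of k B"
  unfolding lists_of_def by auto

lemma map2_symdiff_in_lists_of:
  assumes "xs \<in> lists_of k (Pow I)" "ys \<in> lists_of k (Pow I)"
  shows "map2 (\<oplus>) xs ys \<in> lists_of k (Pow I)"
proof -
  have "y \<in> Pow I" if y: "y \<in> set (map2 (\<oplus>) xs ys)" for y
  proof -
    obtain i where "i < k" "y = xs ! i \<oplus> ys ! i"
      using y assms unfolding in_set_conv_nth lists_of_def by auto
    moreover have "zs ! i \<in> Pow I" if "i < k" "zs \<in> lists_of k (Pow I)" for zs i
      using that nth_mem[of i zs] unfolding lists_of_def by blast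
    moreover note assms
    ultimately show ?thesis using symdiff_in_Pow by metis
  qed
  then show ?thesis using assms unfolding lists_of_def by auto
qed

lemma sdsum_snoc: "sdsum (us @ [u]) = sdsum us \<oplus> u"
  by (induction us) (simp_all add: symdiff_assoc)

definition twisted :: "('b \<Rightarrow> 'a set) \<Rightarrow> ('b list \<Rightarrow> 'a set) \<Rightarrow> 'b list \<Rightarrow> 'a set list" where
  "twisted \<theta> s us = map (\<lambda>i. \<theta> (us ! i) \<oplus> s (take i us)) [0..<length us]"

lemma twisted_snoc: "twisted \<theta> s (us @ [u]) = twisted \<theta> s us @ [\<theta> u \<oplus> s us]"
  unfolding twisted_def by (simp add: nth_append)

text \<open>Each shift \<open>\<theta> (us ! i) \<oplus> s (take i us)\<close> cancels \<open>us ! i\<close> in the shifted factors up to a term that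
  depends on earlier variables only. Hence all factors but the main one drop out by Cauchy--Schwarz,
  applied to the last variable first.\<close>

lemma gowers_pow_ge_twisted_avg:
  fixes f :: "'a set \<Rightarrow> real" and \<theta> :: "'b set \<Rightarrow> 'a set" and b :: "'w \<Rightarrow> 'a set"
  assumes fin: "finite \<Omega>" "finite J" and hom: "\<And>u v. \<theta> (u \<oplus> v) = \<theta> u \<oplus> \<theta> v"
    and f: "\<And>x. \<bar>f x\<bar> \<le> 1"
  shows "(avg \<Omega> (\<lambda>w. avg (Pow J) (\<lambda>u0. avg (lists_of k (Pow J)) (\<lambda>us.
      mult_derivs (twisted \<theta> s us) f (b w \<oplus> (\<theta> u0 \<oplus> \<theta> (sdsum us))))))) ^ (2 ^ k)
    \<le> avg \<Omega> (\<lambda>w. gowers_pow J k (\<lambda>u. f (b w \<oplus> \<theta> u)))"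
  using f
proof (induction k arbitrary: f)
  case 0
  have "\<theta> {} = {}" using hom[of "{}" "{}"] by simp
  then show ?case by (simp add: lists_of_0 avg_const_Pow[OF fin(2)] twisted_def)
next
  case (Suc k)
  define T where "T k f = avg \<Omega> (\<lambda>w. avg (Pow J) (\<lambda>u0. avg (lists_of k (Pow J)) (\<lambda>us.
      mult_derivs (twisted \<theta> s us) f (b w \<oplus> (\<theta> u0 \<oplus> \<theta> (sdsum us))))))" for k and f :: "'a set \<Rightarrow> real"
  let ?D = "\<Omega> \<times> Pow J \<times> lists_of k (Pow J)"
  have finD: "finite ?D" using fin by (intro finite_cartesian_product finite_lists_of) auto
  define c where "c (d :: 'w \<times> 'b set \<times> 'b set list) = (case d of (w, u0, us) \<Rightarrow> b w \<oplus> (\<theta> u0 \<oplus> \<theta> (sdsum us)))" for d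
  define h where "h (d :: 'w \<times> 'b set \<times> 'b set list) = (case d of (w, u0, us) \<Rightarrow> mult_derivs (twisted \<theta> s us) f)" for d
  define q where "q (d :: 'w \<times> 'b set \<times> 'b set list) = (case d of (w, u0, us) \<Rightarrow> h d (c d \<oplus> s us))" for d
  have T_D: "T k g = avg ?D (\<lambda>d. case d of (w, u0, us) \<Rightarrow> mult_derivs (twisted \<theta> s us) g (c d))" for g
    unfolding T_def avg_Times c_def by simp
  \<comment> \<open>In the shifted factor the last variable occurs both in the base point and in the
    direction and cancels. What remains is \<open>q d\<close>, which is bounded by 1.\<close>
  have "T (Suc k) f = avg ?D (\<lambda>d. q d * avg (Pow J) (\<lambda>u. h d (c d \<oplus> \<theta> u)))"
    unfolding T_def avg_Times lists_of_def avg_lists_Suc_snoc avg_cmult[symmetric]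
    by (simp add: c_def h_def q_def twisted_snoc mult_derivs_append sdsum_snoc hom mult_deriv_def symdiff_ac mult_ac)
  then have "(T (Suc k) f)\<^sup>2 \<le> avg ?D (\<lambda>d. (q d * avg (Pow J) (\<lambda>u. h d (c d \<oplus> \<theta> u)))\<^sup>2)"
    using avg_sq_le[OF finD] by simp
  also have "\<dots> \<le> avg ?D (\<lambda>d. (avg (Pow J) (\<lambda>u. h d (c d \<oplus> \<theta> u)))\<^sup>2)"
  proof (rule avg_mono)
    fix d
    have "\<bar>q d\<bar> \<le> 1" unfolding q_def h_def by (auto split: prod.split intro!: mult_derivs_bounded Suc.prems)
    then have "(q d)\<^sup>2 \<le> 1" by (simp add: abs_square_le_1)
    then show "(q d * avg (Pow J) (\<lambda>u. h d (c d \<oplus> \<theta> u)))\<^sup>2 \<le> (avg (Pow J) (\<lambda>u. h d (c d \<oplus> \<theta> u)))\<^sup>2"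
      by (simp add: power_mult_distrib mult_left_le_one_le)
  qed
  also have "\<dots> = avg ?D (\<lambda>d. avg (Pow J) (\<lambda>v. avg (Pow J) (\<lambda>u.
      case d of (w, u0, us) \<Rightarrow> mult_derivs (twisted \<theta> s us) (mult_deriv (\<theta> v) f) (c d \<oplus> \<theta> u))))"
  proof (rule avg_cong)
    fix d :: "'w \<times> 'b set \<times> 'b set list"
    obtain w u0 us where d: "d = (w, u0, us)" by (cases d) auto
    have "(avg (Pow J) (\<lambda>u. h d (c d \<oplus> \<theta> u)))\<^sup>2 =
      avg (Pow J) (\<lambda>u. avg (Pow J) (\<lambda>v. h d (c d \<oplus> \<theta> u) * h d (c d \<oplus> \<theta> v)))"
      unfolding power2_eq_square avg_mult_avg ..
    also have "\<dots> = avg (Pow J) (\<lambda>u. avg (Pow J) (\<lambda>v. h d (c d \<oplus> \<theta> u) * h d (c d \<oplus> \<theta> (v \<oplus> u))))"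
      by (intro avg_cong avg_sym_shift[symmetric, where F = "\<lambda>v. h d (c d \<oplus> \<theta> _) * h d (c d \<oplus> \<theta> v)"])
    also have "\<dots> = avg (Pow J) (\<lambda>v. avg (Pow J) (\<lambda>u. h d (c d \<oplus> \<theta> u) * h d (c d \<oplus> \<theta> (v \<oplus> u))))"
      by (rule avg_swap)
    also have "\<dots> = avg (Pow J) (\<lambda>v. avg (Pow J) (\<lambda>u. mult_derivs (twisted \<theta> s us) (mult_deriv (\<theta> v) f) (c d \<oplus> \<theta> u)))"
      by (simp add: d h_def mult_derivs_mult_deriv_apply hom symdiff_ac)
    finally show "(avg (Pow J) (\<lambda>u. h d (c d \<oplus> \<theta> u)))\<^sup>2 = avg (Pow J) (\<lambda>v. avg (Pow J) (\<lambda>u.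
      case d of (w, u0, us) \<Rightarrow> mult_derivs (twisted \<theta> s us) (mult_deriv (\<theta> v) f) (c d \<oplus> \<theta> u)))" by (simp add: d)
  qed
  also have "\<dots> = avg (Pow J) (\<lambda>v. avg (Pow J) (\<lambda>u. avg ?D (\<lambda>d.
      case d of (w, u0, us) \<Rightarrow> mult_derivs (twisted \<theta> s us) (mult_deriv (\<theta> v) f) (c d \<oplus> \<theta> u))))"
    by (subst avg_swap) (intro avg_cong avg_swap)
  \<comment> \<open>A translation of \<open>u0\<close> absorbs \<open>\<theta> u\<close>; this is
    the purpose of the free variable \<open>u0\<close> in the base point.\<close>
  also have "\<dots> = avg (Pow J) (\<lambda>v. avg (Pow J) (\<lambda>u. T k (mult_deriv (\<theta> v) f)))"
  proof (intro avg_cong)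
    fix v u :: "'b set" assume u: "u \<in> Pow J"
    have "avg (Pow J) (\<lambda>u0. avg (lists_of k (Pow J)) (\<lambda>us. mult_derivs (twisted \<theta> s us) (mult_deriv (\<theta> v) f)
          (b w \<oplus> (\<theta> (u0 \<oplus> u) \<oplus> \<theta> (sdsum us))))) =
        avg (Pow J) (\<lambda>u0. avg (lists_of k (Pow J)) (\<lambda>us. mult_derivs (twisted \<theta> s us) (mult_deriv (\<theta> v) f)
          (b w \<oplus> (\<theta> u0 \<oplus> \<theta> (sdsum us)))))" for w
      by (rule avg_sym_shift[OF u])
    then show "avg ?D (\<lambda>d. case d of (w, u0, us) \<Rightarrow> mult_derivs (twisted \<theta> s us) (mult_deriv (\<theta> v) f) (c d \<oplus> \<theta> u)) =
        T k (mult_deriv (\<theta> v) f)"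
      unfolding T_def avg_Times c_def by (simp add: hom symdiff_ac)
  qed
  also have "\<dots> = avg (Pow J) (\<lambda>v. T k (mult_deriv (\<theta> v) f))"
    using fin by (intro avg_cong avg_const) auto
  finally have sq: "(T (Suc k) f)\<^sup>2 \<le> avg (Pow J) (\<lambda>v. T k (mult_deriv (\<theta> v) f))" .
  have "T (Suc k) f ^ (2 ^ Suc k) = ((T (Suc k) f)\<^sup>2) ^ (2 ^ k)" by (simp add: power_mult)
  also have "\<dots> \<le> (avg (Pow J) (\<lambda>v. T k (mult_deriv (\<theta> v) f))) ^ (2 ^ k)"
    by (intro power_mono sq) simp
  also have "\<dots> \<le> avg (Pow J) (\<lambda>v. T k (mult_deriv (\<theta> v) f) ^ (2 ^ k))"
    using fin by (intro avg_power_le) simp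
  also have "\<dots> \<le> avg (Pow J) (\<lambda>v. avg \<Omega> (\<lambda>w. gowers_pow J k (\<lambda>u. mult_deriv (\<theta> v) f (b w \<oplus> \<theta> u))))"
    unfolding T_def by (intro avg_mono Suc.IH mult_deriv_bounded Suc.prems)
  also have "\<dots> = avg \<Omega> (\<lambda>w. avg (Pow J) (\<lambda>v. gowers_pow J k (\<lambda>u. mult_deriv (\<theta> v) f (b w \<oplus> \<theta> u))))"
    by (rule avg_swap)
  also have "\<dots> = avg \<Omega> (\<lambda>w. gowers_pow J (Suc k) (\<lambda>u. f (b w \<oplus> \<theta> u)))"
    by (simp add: mult_deriv_def hom symdiff_assoc)
  finally show ?case unfolding T_def .
qed

text \<open>Bessel's inequality bounds the sum over all blocks by 1 for \<open>f\<close> and by 1 on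
  average over the derivatives. Including \<open>f\<close> itself ensures that planting nearly
  preserves its mean.\<close>

lemma exists_low_variance_block:
  fixes E :: "'j \<Rightarrow> 'a set"
  assumes fin: "finite I" "finite J" and J: "J \<noteq> {}" and E: "\<And>j. j \<in> J \<Longrightarrow> E j \<subseteq> I"
    and disj: "\<And>i j. i \<in> J \<Longrightarrow> j \<in> J \<Longrightarrow> i \<noteq> j \<Longrightarrow> E i \<inter> E j = {}"
    and bd: "\<And>Y x. \<bar>F Y x\<bar> \<le> 1" "\<And>x. \<bar>f x\<bar> \<le> 1" and YY: "finite YY" "YY \<noteq> {}"
  shows "\<exists>j\<in>J. avg YY (\<lambda>Y. cond_var I (E j) (F Y)) + cond_var I (E j) f \<le> 2 / real (card J)"
proof -
  define G where "G j = avg YY (\<lambda>Y. cond_var I (E j) (F Y)) + cond_var I (E j) f" for j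
  have "(\<Sum>j\<in>J. G j) = avg YY (\<lambda>Y. \<Sum>j\<in>J. cond_var I (E j) (F Y)) + (\<Sum>j\<in>J. cond_var I (E j) f)"
    unfolding G_def by (simp add: sum.distrib sum_avg)
  also have "\<dots> \<le> avg YY (\<lambda>Y. 1) + 1"
    by (intro add_mono avg_mono sum_cond_var_le_1 fin E disj bd)
  also have "\<dots> = 2" using YY by (simp add: avg_const)
  finally have "(\<Sum>j\<in>J. G j) / real (card J) \<le> 2 / real (card J)"
    by (rule divide_right_mono) simp
  then have "- (2 / real (card J)) \<le> avg J (\<lambda>j. - G j)"
    unfolding avg_def sum_negf by simp
  from avg_ge_ex[OF fin(2) J this] obtain j where "j \<in> J" "G j \<le> 2 / real (card J)" by auto
  then show ?thesis unfolding G_def by blast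
qed

text \<open>For fixed \<open>ls\<close> the map \<open>\<tau> \<mapsto> corrected I R e f (map2 (\<oplus>) vs \<tau>) ls\<close> is injective, so a random
  \<open>\<tau>\<close> avoids the few tuples of shifts that are sensitive to the coordinates in \<open>E\<close>.\<close>

lemma exists_generic_shift:
  assumes fin: "finite I" and E: "E \<subseteq> I" and c0: "0 < c0"
    and small: "avg (lists_of k (Pow I)) (\<lambda>Y. cond_var I E (mult_derivs Y f)) \<le> \<delta>"
    and \<delta>: "(2 ^ card E) ^ k * real R ^ k * (2 ^ card E * \<delta> / c0\<^sup>2) < 1"
  shows "\<exists>\<tau>\<in>lists_of k (Pow I). \<forall>vs\<in>lists_of k (Pow E). \<forall>ls\<in>lists_of k {..<R}. \<forall>p\<in>Pow E.
    \<bar>cond_avg I E (mult_derivs (corrected I R e f (map2 (\<oplus>) vs \<tau>) ls) f) p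
      - avg (Pow I) (mult_derivs (corrected I R e f (map2 (\<oplus>) vs \<tau>) ls) f)\<bar> \<le> c0"
proof (rule ccontr)
  assume neg: "\<not> ?thesis"
  define L where "L = lists_of k (Pow I)"
  define VL where "VL = lists_of k (Pow E) \<times> lists_of k {..<R}"
  \<comment> \<open>The assumption to be refuted says that every \<open>\<tau>\<close> is sent into
    \<open>Bad\<close> by some \<open>vs\<close> and \<open>ls\<close>; each such pair accounts for
    at most \<open>card Bad\<close> of them.\<close>
  define Bad where "Bad = {Y\<in>L. \<exists>p\<in>Pow E. c0 < \<bar>cond_avg I E (mult_derivs Y f) p - avg (Pow I) (mult_derivs Y f)\<bar>}"
  have finE: "finite E" using E fin finite_subset by blast
  have finL: "finite L" and finVL: "finite VL" unfolding L_def VL_def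
    using fin finE by (auto intro!: finite_lists_of)
  have cL: "card L > 0" using finL lists_of_nonempty[of "{}" "Pow I" k]
    unfolding L_def by (simp add: card_gt_0_iff)
  have finBad: "finite Bad" unfolding Bad_def using finL by simp
  define cor where "cor = (\<lambda>(vs, ls) \<tau>. corrected I R e f (map2 (\<oplus>) vs \<tau>) ls)"
  have cor_L: "cor (vs, ls) \<tau> \<in> L" if "(vs, ls) \<in> VL" "\<tau> \<in> L" for vs ls \<tau>
  proof -
    have "map2 (\<oplus>) vs \<tau> \<in> lists_of k (Pow I)"
      using that E lists_of_mono[of vs k "Pow E" "Pow I"] unfolding VL_def L_def
      by (intro map2_symdiff_in_lists_of) auto
    then have "set (map2 (\<oplus>) vs \<tau>) \<subseteq> Pow I" unfolding lists_of_def by blast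
    from corrected_in_Pow[OF fin this] show ?thesis
      using that unfolding cor_def L_def VL_def lists_of_def by (simp add: length_corrected)
  qed
  have "L \<subseteq> (\<Union>d\<in>VL. {\<tau>\<in>L. cor d \<tau> \<in> Bad})"
  proof
    fix \<tau> assume \<tau>: "\<tau> \<in> L"
    then obtain vs ls p where *: "vs \<in> lists_of k (Pow E)" "ls \<in> lists_of k {..<R}" "p \<in> Pow E"
      "c0 < \<bar>cond_avg I E (mult_derivs (cor (vs, ls) \<tau>) f) p - avg (Pow I) (mult_derivs (cor (vs, ls) \<tau>) f)\<bar>"
      using neg unfolding L_def cor_def by (auto simp: not_le)
    then show "\<tau> \<in> (\<Union>d\<in>VL. {\<tau>\<in>L. cor d \<tau> \<in> Bad})"
      using \<tau> cor_L[of vs ls \<tau>] unfolding VL_def Bad_def by blast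
  qed
  then have "card L \<le> card (\<Union>d\<in>VL. {\<tau>\<in>L. cor d \<tau> \<in> Bad})"
    using finL finVL by (intro card_mono) auto
  also have "\<dots> \<le> (\<Sum>d\<in>VL. card {\<tau>\<in>L. cor d \<tau> \<in> Bad})" by (rule card_UN_le[OF finVL])
  also have "\<dots> \<le> (\<Sum>d\<in>VL. card Bad)"
  proof (rule sum_mono)
    fix d assume d: "d \<in> VL"
    obtain vs ls where dd: "d = (vs, ls)" by (cases d)
    have "inj_on (cor d) {\<tau>\<in>L. cor d \<tau> \<in> Bad}"
    proof (rule inj_onI)
      fix \<tau> \<tau>' assume t: "\<tau> \<in> {\<tau>\<in>L. cor d \<tau> \<in> Bad}" "\<tau>' \<in> {\<tau>\<in>L. cor d \<tau> \<in> Bad}" "cor d \<tau> = cor d \<tau>'"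
      then have len: "length \<tau> = length vs" "length \<tau>' = length vs" "length ls = length vs"
        using d dd unfolding L_def VL_def lists_of_def by auto
      then have eq: "map2 (\<oplus>) vs \<tau> = map2 (\<oplus>) vs \<tau>'"
        using t(3) unfolding cor_def dd by (auto intro: corrected_inj)
      show "\<tau> = \<tau>'"
      proof (rule nth_equalityI)
        fix i assume i: "i < length \<tau>"
        then have "vs ! i \<oplus> \<tau> ! i = vs ! i \<oplus> \<tau>' ! i"
          using len arg_cong[OF eq, of "\<lambda>l. l ! i"] by simp
        then show "\<tau> ! i = \<tau>' ! i" by (metis symdiff_cancel)
      qed (use len in simp)
    qed
    then show "card {\<tau>\<in>L. cor d \<tau> \<in> Bad} \<le> card Bad"
      using finBad by (intro card_inj_on_le) auto
  qed
  also have "\<dots> = card VL * card Bad" by simp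
  finally have 1: "real (card L) \<le> real (card VL) * real (card Bad)"
    by (simp flip: of_nat_mult)
  have cVL: "real (card VL) = (2 ^ card E) ^ k * real R ^ k"
    unfolding VL_def using finE by (simp add: card_cartesian_product card_lists_of card_Pow)
  \<comment> \<open>Chebyshev's inequality: a bad tuple has conditional variance at least
    \<open>c0\<^sup>2 / 2 ^ card E\<close>.\<close>
  have "real (card Bad) * (c0\<^sup>2 / 2 ^ card E) = (\<Sum>Y\<in>Bad. c0\<^sup>2 / 2 ^ card E)" by simp
  also have "\<dots> \<le> (\<Sum>Y\<in>Bad. cond_var I E (mult_derivs Y f))"
  proof (rule sum_mono)
    fix Y assume "Y \<in> Bad"
    then obtain p where p: "p \<in> Pow E" "c0 < \<bar>cond_avg I E (mult_derivs Y f) p - avg (Pow I) (mult_derivs Y f)\<bar>"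
      unfolding Bad_def by blast
    have "c0\<^sup>2 \<le> \<bar>cond_avg I E (mult_derivs Y f) p - avg (Pow I) (mult_derivs Y f)\<bar>\<^sup>2"
      using p(2) c0 by (intro power_mono) auto
    also have "\<dots> \<le> 2 ^ card E * cond_var I E (mult_derivs Y f)"
      using cond_avg_deviation_le[OF fin E p(1)] by simp
    finally show "c0\<^sup>2 / 2 ^ card E \<le> cond_var I E (mult_derivs Y f)" by (simp add: divide_le_eq mult.commute)
  qed
  also have "\<dots> \<le> (\<Sum>Y\<in>L. cond_var I E (mult_derivs Y f))"
    by (rule sum_mono2[OF finL]) (auto simp: Bad_def cond_var_nonneg)
  also have "\<dots> \<le> real (card L) * \<delta>"
    using small cL unfolding avg_def L_def[symmetric] by (simp add: divide_le_eq mult.commute)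
  finally have "real (card Bad) \<le> real (card L) * (2 ^ card E * \<delta> / c0\<^sup>2)"
    using c0 by (simp add: field_simps)
  then have "real (card L) \<le> real (card VL) * (real (card L) * (2 ^ card E * \<delta> / c0\<^sup>2))"
    using 1 by (meson mult_left_mono of_nat_0_le_iff order_trans)
  also have "\<dots> = real (card L) * ((2 ^ card E) ^ k * real R ^ k * (2 ^ card E * \<delta> / c0\<^sup>2))"
    unfolding cVL by simp
  also have "\<dots> < real (card L) * 1"
    using cL \<delta> by (intro mult_strict_left_mono) auto
  finally show False by simp
qed

text \<open>The base points \<open>\<theta> u0 \<oplus> \<theta> (sdsum us)\<close> lie in the
  block, so averaging over the other coordinates gives a conditional mean, which \<open>mono\<close>
  bounds from below with the same sign throughout. The translate \<open>z\<close>, the shift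
  \<open>\<tau>\<close> and the corrections are all moved into the directions, where
  \<open>gowers_pow_ge_twisted_avg\<close> eliminates them.\<close>

lemma gowers_pow_planted_ge:
  fixes \<theta> :: "'b set \<Rightarrow> 'a set"
  assumes fin: "finite I" "finite J" and E: "E \<subseteq> I"
    and hom: "\<And>u v. \<theta> (u \<oplus> v) = \<theta> u \<oplus> \<theta> v" and \<theta>E: "\<And>u. \<theta> u \<subseteq> E"
    and f: "\<And>x. \<bar>f x\<bar> \<le> 1" and k: "k \<noteq> 0" and c0: "0 \<le> c0"
    and len: "length z = k" "length \<tau> = k" "length ls = k" and \<sigma>: "\<bar>\<sigma>\<bar> = (1::real)"
    and mono: "\<And>us p. us \<in> lists_of k (Pow J) \<Longrightarrow> p \<in> Pow E \<Longrightarrow>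
      c0 \<le> \<sigma> * cond_avg I E (mult_derivs (corrected I R e f (map2 (\<oplus>) (map2 (\<oplus>) z (map \<theta> us)) \<tau>) ls) f) p"
  shows "c0 ^ (2 ^ k) \<le> avg (Pow (I - E)) (\<lambda>x. gowers_pow J k (\<lambda>u. f (x \<oplus> \<theta> u)))"
proof -
  \<comment> \<open>Everything in a direction apart from its own \<open>\<theta> (us ! i)\<close> is
    a function of the preceding entries; \<open>length p\<close> recovers the index
    \<open>i\<close>.\<close>
  define s where "s p = z ! length p \<oplus> \<tau> ! length p \<oplus>
    correction I R e k f ls (map (\<lambda>i. z ! i \<oplus> \<theta> (p ! i) \<oplus> \<tau> ! i) [0..<length p])" for p
  have tw: "corrected I R e f (map2 (\<oplus>) (map2 (\<oplus>) z (map \<theta> us)) \<tau>) ls = twisted \<theta> s us"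
    if "length us = k" for us
  proof (rule nth_equalityI)
    show "length (corrected I R e f (map2 (\<oplus>) (map2 (\<oplus>) z (map \<theta> us)) \<tau>) ls) = length (twisted \<theta> s us)"
      using that len by (simp add: length_corrected twisted_def)
    fix i assume "i < length (corrected I R e f (map2 (\<oplus>) (map2 (\<oplus>) z (map \<theta> us)) \<tau>) ls)"
    then have i: "i < k" using that len by (simp add: length_corrected)
    have "take i (map2 (\<oplus>) (map2 (\<oplus>) z (map \<theta> us)) \<tau>) = map (\<lambda>j. z ! j \<oplus> \<theta> (take i us ! j) \<oplus> \<tau> ! j) [0..<i]"
      by (rule nth_equalityI) (use i that len in auto)
    then show "corrected I R e f (map2 (\<oplus>) (map2 (\<oplus>) z (map \<theta> us)) \<tau>) ls ! i = twisted \<theta> s us ! i"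
      using i that len by (simp add: corrected_nth twisted_def s_def symdiff_ac min_def)
  qed
  let ?T = "avg (Pow (I - E)) (\<lambda>x. avg (Pow J) (\<lambda>u0. avg (lists_of k (Pow J)) (\<lambda>us.
      mult_derivs (twisted \<theta> s us) f (x \<oplus> (\<theta> u0 \<oplus> \<theta> (sdsum us))))))"
  have "?T = avg (Pow J) (\<lambda>u0. avg (lists_of k (Pow J)) (\<lambda>us.
      cond_avg I E (mult_derivs (twisted \<theta> s us) f) (\<theta> u0 \<oplus> \<theta> (sdsum us))))"
    unfolding cond_avg_def by (subst avg_swap, rule avg_cong, subst avg_swap) (simp add: symdiff_ac)
  then have "\<sigma> * ?T = avg (Pow J) (\<lambda>u0. avg (lists_of k (Pow J)) (\<lambda>us.
      \<sigma> * cond_avg I E (mult_derivs (twisted \<theta> s us) f) (\<theta> u0 \<oplus> \<theta> (sdsum us))))"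
    by (simp add: avg_cmult)
  also have "\<dots> \<ge> avg (Pow J) (\<lambda>u0. avg (lists_of k (Pow J)) (\<lambda>us. c0))"
  proof (intro avg_mono)
    fix u0 us assume us: "us \<in> lists_of k (Pow J)"
    have "\<theta> u0 \<oplus> \<theta> (sdsum us) \<in> Pow E" by (intro symdiff_in_Pow) (use \<theta>E in auto)
    from mono[OF us this] show "c0 \<le> \<sigma> * cond_avg I E (mult_derivs (twisted \<theta> s us) f) (\<theta> u0 \<oplus> \<theta> (sdsum us))"
      using tw[of us] us by (simp add: lists_of_def)
  qed
  also have "avg (Pow J) (\<lambda>u0. avg (lists_of k (Pow J)) (\<lambda>us. c0)) = c0"
    using fin finite_lists_of[of "Pow J" k] lists_of_nonempty[of "{}" "Pow J" k]
    by (simp add: avg_const avg_const_Pow)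
  finally have "c0 \<le> \<bar>?T\<bar>" using \<sigma> by (smt (verit) abs_mult mult_cancel_right1 mult_minus_left)
  then have "c0 ^ (2 ^ k) \<le> \<bar>?T\<bar> ^ (2 ^ k)" using c0 by (intro power_mono)
  \<comment> \<open>As \<open>k\<close> is nonzero the exponent is even, so the sign of the average
    disappears.\<close>
  also have "\<dots> = ?T ^ (2 ^ k)" using k by (intro power_even_abs) simp
  also have "\<dots> \<le> avg (Pow (I - E)) (\<lambda>x. gowers_pow J k (\<lambda>u. f (x \<oplus> \<theta> u)))"
    by (rule gowers_pow_ge_twisted_avg) (use fin hom f in auto)
  finally show ?thesis .
qed

section \<open>Blow-ups of graphs\<close>

text \<open>An edge inside a fibre of \<open>w\<close> has a singleton as image, so it is governed
  by a loop of \<open>u\<close>.\<close>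

definition blowup :: "nat set \<Rightarrow> (nat \<Rightarrow> nat) \<Rightarrow> nat set set \<Rightarrow> nat set set" where
  "blowup S w u = {e \<in> le2_subsets S. w ` e \<in> u}"

lemma blowup_symdiff: "blowup S w (u \<oplus> v) = blowup S w u \<oplus> blowup S w v"
  unfolding blowup_def symdiff_def by auto

lemma blowup_subset: "blowup S w u \<subseteq> le2_subsets S"
  unfolding blowup_def by auto

lemma finite_le2_subsets: "finite V \<Longrightarrow> finite (le2_subsets V)"
  unfolding le2_subsets_def by simp

lemma finite_pairs_upto: "finite (pairs_upto n)"
  unfolding pairs_upto_def by (simp add: finite_le2_subsets)

lemma le2_subsets_mono: "S \<subseteq> T \<Longrightarrow> le2_subsets S \<subseteq> le2_subsets T"
  unfolding le2_subsets_def by auto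

lemma sum_fun_apply: "(\<Sum>x\<in>A. F x) y = (\<Sum>x\<in>A. F x y)"
  by (induction A rule: infinite_finite_induct) (auto simp: zero_fun_def plus_fun_def)

lemma bit_add_eq_1: "a + b = (1::bit) \<longleftrightarrow> (a = 1) \<noteq> (b = 1)"
  by (cases a; cases b) auto

text \<open>A vertex \<open>(b, j)\<close> is the \<open>j\<close>-th copy of \<open>b\<close>. Evaluated at \<open>B\<close>, this map is the
  indicator of the blow-ups of the graphs \<open>us ! i\<close> with vertex classes \<open>B \<times> {j}\<close>.\<close>

definition clique_map :: "nat set set list \<Rightarrow>
    (nat \<Rightarrow> nat \<Rightarrow> nat \<times> (nat \<times> nat) set \<Rightarrow> bit) \<times> (nat \<Rightarrow> nat \<times> (nat \<times> nat) set \<Rightarrow> bit)" where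
  "clique_map us =
    (\<lambda>b b' x. of_bool (fst ` snd x = {b, b'} \<and> snd ` snd x \<in> us ! fst x),
     \<lambda>b x. of_bool (fst ` snd x = {b} \<and> snd ` snd x \<in> us ! fst x))"

text \<open>Values are in F_2, so double counting would cancel. An edge projecting to
  \<open>{b}\<close> is matched only by the linear term at \<open>b\<close>, and one projecting to
  \<open>{b, b'}\<close> with \<open>b < b'\<close> only by the term of that ordered pair.\<close>

lemma quad_eval_clique_map:
  assumes "finite B" "e \<noteq> {}" "finite e" "card e \<le> 2"
  shows "quad_eval (clique_map us) B (i, e) = of_bool (fst ` e \<subseteq> B \<and> snd ` e \<in> us ! i)"
proof -
  let ?P = "snd ` e \<in> us ! i"
  have eq: "quad_eval (clique_map us) B (i, e) =
    (\<Sum>j\<in>B. of_bool (fst ` e = {j} \<and> ?P) + (\<Sum>a\<in>{a\<in>B. a < j}. of_bool (fst ` e = {a, j} \<and> ?P)))"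
    unfolding quad_eval_def clique_map_def by (simp add: sum_fun_apply plus_fun_def)
  have "card (fst ` e) \<le> 2" using card_image_le[OF assms(3), of fst] assms(4) by linarith
  moreover have "fst ` e \<noteq> {}" "finite (fst ` e)" using assms by auto
  ultimately have "card (fst ` e) = 1 \<or> card (fst ` e) = 2"
    by (metis One_nat_def card_0_eq le_Suc_eq numeral_2_eq_2 le_zero_eq)
  then consider b where "fst ` e = {b}" | b b' where "fst ` e = {b, b'}" "b < b'"
    unfolding card_1_singleton_iff One_nat_def card_2_iff
    by (metis insert_commute nat_neq_iff)
  then show ?thesis
  proof cases
    case 1
    then have "{b} = {a, j} \<longleftrightarrow> a = b \<and> j = b" for a j by auto
    then have "(\<Sum>a\<in>{a\<in>B. a < j}. of_bool (fst ` e = {a, j} \<and> ?P)) = (0::bit)" for j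
      using 1 by (intro sum.neutral) auto
    then have "quad_eval (clique_map us) B (i, e) = (\<Sum>j\<in>B. if j = b then of_bool ?P else 0)"
      unfolding eq 1 by (intro sum.cong) auto
    then show ?thesis using 1 assms(1) by simp
  next
    case 2
    have "(\<Sum>a\<in>{a\<in>B. a < j}. of_bool (fst ` e = {a, j} \<and> ?P)) =
        (if j = b' then of_bool (b \<in> B \<and> ?P) else (0::bit))" if "j \<in> B" for j
    proof -
      have "{b, b'} = {a, j} \<longleftrightarrow> a = b \<and> j = b'" if "a < j" for a
        using that 2(2) by (auto simp: doubleton_eq_iff)
      then have "(\<Sum>a\<in>{a\<in>B. a < j}. of_bool (fst ` e = {a, j} \<and> ?P)) =
          (\<Sum>a\<in>{a\<in>B. a < j}. if a = b then of_bool (j = b' \<and> ?P) else (0::bit))"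
        unfolding 2(1) by (intro sum.cong) auto
      then show ?thesis using assms(1) 2(2) by auto
    qed
    moreover have "fst ` e \<noteq> {j}" for j using 2 by auto
    ultimately have "quad_eval (clique_map us) B (i, e) = (\<Sum>j\<in>B. if j = b' then of_bool (b \<in> B \<and> ?P) else 0)"
      unfolding eq by (intro sum.cong) auto
    then show ?thesis using 2 assms(1) by auto
  qed
qed

text \<open>The colouring is pulled back along \<open>tup\<close> to functions on abstract edges
  between vertices \<open>(b, j)\<close>, tagged with the position in the tuple. These do not refer
  to \<open>A\<close>, \<open>\<beta>\<close> or \<open>w\<close>, so one \<open>N\<close> serves
  every block of vertices.\<close>

lemma graph_HJ:
  assumes "finite X"
  shows "\<exists>N::nat. \<forall>A \<beta> w col. finite A \<longrightarrow> (\<forall>vs\<in>lists_of k (Pow (le2_subsets A)). col vs \<in> (X :: 'c set)) \<longrightarrow>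
    (\<exists>z\<in>lists_of k (Pow (le2_subsets A)). \<exists>B::nat set. B \<subseteq> {..<N} \<and> B \<noteq> {} \<and>
      (\<forall>us\<in>lists_of k (Pow (pairs_upto M)).
        col (map2 (\<oplus>) z (map (blowup {v\<in>A. \<beta> v \<in> B} w) us)) = col z))"
proof -
  have "finite (clique_map ` lists_of k (Pow (pairs_upto M)))"
    by (intro finite_imageI finite_lists_of) (simp add: finite_pairs_upto)
  from poly_HJ_finite_colours[OF poly_HJ[OF this] assms, of 0]
  obtain N C where "finite C" and N: "\<And>col :: (nat \<times> (nat \<times> nat) set \<Rightarrow> bit) \<Rightarrow> 'c. (\<And>g. col g \<in> X) \<Longrightarrow>
      \<exists>z\<in>C. \<exists>B. B \<subseteq> {0..<N} \<and> B \<noteq> {} \<and>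
        (\<forall>q\<in>clique_map ` lists_of k (Pow (pairs_upto M)). col (z + quad_eval q B) = col z)" by metis
  show ?thesis
  proof (rule exI[of _ N], intro allI impI)
    fix A :: "nat set" and \<beta> w :: "nat \<Rightarrow> nat" and col :: "nat set set list \<Rightarrow> 'c"
    assume A: "finite A" and col: "\<forall>vs\<in>lists_of k (Pow (le2_subsets A)). col vs \<in> X"
    define tup where "tup g = map (\<lambda>i. {e\<in>le2_subsets A. g (i, (\<lambda>v. (\<beta> v, w v)) ` e) = 1}) [0..<k]"
      for g :: "nat \<times> (nat \<times> nat) set \<Rightarrow> bit"
    have tup_in: "tup g \<in> lists_of k (Pow (le2_subsets A))" for g
      unfolding tup_def lists_of_def by auto
    obtain z B where B: "B \<subseteq> {0..<N}" "B \<noteq> {}" and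
      z: "\<And>us. us \<in> lists_of k (Pow (pairs_upto M)) \<Longrightarrow> col (tup (z + quad_eval (clique_map us) B)) = col (tup z)"
      using N[of "\<lambda>g. col (tup g)"] col tup_in by blast
    have finB: "finite B" using B(1) finite_subset by blast
    have tup_eq: "tup (z + quad_eval (clique_map us) B) = map2 (\<oplus>) (tup z) (map (blowup {v\<in>A. \<beta> v \<in> B} w) us)"
      if us: "us \<in> lists_of k (Pow (pairs_upto M))" for us
    proof (rule nth_equalityI)
      show len: "length (tup (z + quad_eval (clique_map us) B)) =
          length (map2 (\<oplus>) (tup z) (map (blowup {v\<in>A. \<beta> v \<in> B} w) us))"
        using us by (simp add: tup_def lists_of_def)
      fix i assume "i < length (tup (z + quad_eval (clique_map us) B))"
      then have i: "i < k" "i < length us" using us by (auto simp: tup_def lists_of_def)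
      have q: "quad_eval (clique_map us) B (i, (\<lambda>v. (\<beta> v, w v)) ` e) = of_bool (\<beta> ` e \<subseteq> B \<and> w ` e \<in> us ! i)"
        if e: "e \<in> le2_subsets A" for e
      proof -
        have "finite e" "e \<noteq> {}" "card e \<le> 2"
          using e A finite_subset unfolding le2_subsets_def by auto
        then have "card ((\<lambda>v. (\<beta> v, w v)) ` e) \<le> 2"
          using card_image_le[of e "\<lambda>v. (\<beta> v, w v)"] by linarith
        then show ?thesis using \<open>finite e\<close> \<open>e \<noteq> {}\<close>
          by (subst quad_eval_clique_map[OF finB]) (auto simp: image_image)
      qed
      have "{e\<in>le2_subsets A. (z + quad_eval (clique_map us) B) (i, (\<lambda>v. (\<beta> v, w v)) ` e) = 1} =
         {e\<in>le2_subsets A. z (i, (\<lambda>v. (\<beta> v, w v)) ` e) = 1} \<oplus> {e\<in>le2_subsets A. \<beta> ` e \<subseteq> B \<and> w ` e \<in> us ! i}"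
        by (auto simp: plus_fun_def bit_add_eq_1 q symdiff_def image_subset_iff)
      also have "{e\<in>le2_subsets A. \<beta> ` e \<subseteq> B \<and> w ` e \<in> us ! i} = blowup {v\<in>A. \<beta> v \<in> B} w (us ! i)"
        unfolding blowup_def le2_subsets_def by auto
      finally show "tup (z + quad_eval (clique_map us) B) ! i =
          map2 (\<oplus>) (tup z) (map (blowup {v\<in>A. \<beta> v \<in> B} w) us) ! i"
        using i by (simp add: tup_def)
    qed
    have "\<forall>us\<in>lists_of k (Pow (pairs_upto M)).
        col (map2 (\<oplus>) (tup z) (map (blowup {v\<in>A. \<beta> v \<in> B} w) us)) = col (tup z)"
    proof
      fix us assume us: "us \<in> lists_of k (Pow (pairs_upto M))"
      show "col (map2 (\<oplus>) (tup z) (map (blowup {v\<in>A. \<beta> v \<in> B} w) us)) = col (tup z)"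
        using z[OF us] unfolding tup_eq[OF us] .
    qed
    then show "\<exists>z\<in>lists_of k (Pow (le2_subsets A)). \<exists>B. B \<subseteq> {..<N} \<and> B \<noteq> {} \<and>
      (\<forall>us\<in>lists_of k (Pow (pairs_upto M)).
        col (map2 (\<oplus>) z (map (blowup {v\<in>A. \<beta> v \<in> B} w) us)) = col z)"
      using B by (intro bexI[OF _ tup_in] exI[of _ B] conjI) auto
  qed
qed

text \<open>As \<open>x\<close> avoids \<open>E\<close>, the planted graph is empty in the part of
  \<open>E\<close> outside \<open>le2_subsets S\<close>. Both bounds average over the same
  \<open>x\<close>, so they can be combined to find one \<open>x\<close> good for norm and
  density.\<close>

definition blowup_with :: "nat \<Rightarrow> nat \<Rightarrow> nat \<Rightarrow> real \<Rightarrow> real \<Rightarrow> (nat set set \<Rightarrow> real) \<Rightarrow> bool" where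
  "blowup_with n M k c \<gamma> f \<longleftrightarrow>
    (\<exists>S w E. S \<subseteq> {1..n} \<and> w ` S = {1..M} \<and> E \<subseteq> pairs_upto n \<and> le2_subsets S \<subseteq> E \<and>
      c \<le> avg (Pow (pairs_upto n - E)) (\<lambda>x. gowers_pow (pairs_upto M) k (\<lambda>u. f (x \<oplus> blowup S w u))) \<and>
      avg (Pow (pairs_upto n)) f - \<gamma> \<le>
        avg (Pow (pairs_upto n - E)) (\<lambda>x. avg (Pow (pairs_upto M)) (\<lambda>u. f (x \<oplus> blowup S w u))))"

text \<open>The constant and the number of colours, \<open>2 * R ^ k\<close>, come from
  \<open>\<epsilon>\<close> and \<open>k\<close> alone. \<open>M\<close> and \<open>\<gamma>\<close>
  influence only \<open>N\<close>, the size of the blocks and their number \<open>q\<close>.\<close>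

theorem gowers_pow_degree_lowering:
  fixes k :: nat and \<epsilon> :: real
  assumes k: "k \<noteq> 0" and \<epsilon>: "0 < \<epsilon>"
  shows "\<exists>c>0. \<forall>M \<gamma>. 0 < M \<longrightarrow> 0 < \<gamma> \<longrightarrow> (\<exists>n0. \<forall>n\<ge>n0. \<forall>f. (\<forall>x. \<bar>f x\<bar> \<le> 1) \<longrightarrow>
    \<epsilon> \<le> gowers_pow (pairs_upto n) (Suc k) f \<longrightarrow>
    blowup_with n M k c \<gamma> f)"
proof -
  \<comment> \<open>Corrected means have absolute value at least \<open>2 * c0\<close>, and
    conditioning on the block may cost \<open>c0\<close>.\<close>
  define c0 where "c0 = sqrt (\<epsilon> / 2 ^ k) / 2"
  have c0: "0 < c0" unfolding c0_def using \<epsilon> by simp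
  define R where "R = nat \<lceil>2 ^ Suc k / \<epsilon>\<rceil>"
  have R: "2 ^ Suc k / \<epsilon> \<le> real R" unfolding R_def by linarith
  define X where "X = lists_of k {..<R} \<times> {1, - 1 :: real}"
  have finX: "finite X" unfolding X_def by (simp add: finite_lists_of)
  show ?thesis
  proof (intro exI[of _ "c0 ^ (2 ^ k)"] conjI allI impI)
    show "0 < c0 ^ (2 ^ k)" using c0 by simp
    fix M :: nat and \<gamma> :: real assume M: "0 < M" and \<gamma>: "0 < \<gamma>"
    obtain N :: nat where N: "\<forall>A \<beta> w col. finite A \<longrightarrow>
      (\<forall>vs\<in>lists_of k (Pow (le2_subsets A)). col vs \<in> X) \<longrightarrow>
      (\<exists>z\<in>lists_of k (Pow (le2_subsets A)). \<exists>B::nat set. B \<subseteq> {..<N} \<and> B \<noteq> {} \<and>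
        (\<forall>us\<in>lists_of k (Pow (pairs_upto M)).
          col (map2 (\<oplus>) z (map (blowup {v\<in>A. \<beta> v \<in> B} w) us)) = col z))"
      using graph_HJ[OF finX, of k M] by (rule exE)
    \<comment> \<open>A block has one vertex for each pair of a base point below \<open>N\<close>
      and a vertex of \<open>{1..M}\<close>.\<close>
    define D where "D = N * M"
    \<comment> \<open>A crude bound for the number of graphs on a block: its edges are counted among
      all \<open>2 ^ D\<close> sets of vertices.\<close>
    define K :: real where "K = 2 ^ (2 ^ D)"
    have K: "0 < K" unfolding K_def by simp
    \<comment> \<open>The variances will be at most \<open>2 / q\<close>. The first summand makes
      the counting in \<open>exists_generic_shift\<close> succeed, the second keeps \<open>f\<close>
      within \<open>\<gamma>\<close> of its mean at every point of the block.\<close>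
    define Z where "Z = K ^ k * real R ^ k * (K * 2 / c0\<^sup>2) + K * 2 / \<gamma>\<^sup>2 + 1"
    define q where "q = nat \<lceil>Z\<rceil>"
    have Z1: "Z \<ge> 1" unfolding Z_def using K by simp
    then have q: "Z \<le> real q" "0 < q" unfolding q_def by linarith+
    define A where "A i = {i * D + 1..(i + 1) * D}" for i
    define E where "E i = le2_subsets (A i)" for i
    have cE: "2 ^ card (E i) \<le> K" for i
    proof -
      have "card (E i) \<le> card (Pow (A i))"
        unfolding E_def le2_subsets_def by (intro card_mono) (auto simp: A_def)
      also have "\<dots> = 2 ^ D" by (simp add: card_Pow A_def)
      finally show ?thesis unfolding K_def by (intro power_increasing) auto
    qed
    show "\<exists>n0. \<forall>n\<ge>n0. \<forall>f. (\<forall>x. \<bar>f x\<bar> \<le> 1) \<longrightarrow> \<epsilon> \<le> gowers_pow (pairs_upto n) (Suc k) f \<longrightarrow>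
      blowup_with n M k (c0 ^ (2 ^ k)) \<gamma> f"
    proof (rule exI[of _ "q * D"], intro allI impI)
      fix n f assume n: "q * D \<le> n" and "\<forall>x. \<bar>f x\<bar> \<le> 1" and g: "\<epsilon> \<le> gowers_pow (pairs_upto n) (Suc k) f"
      then have f: "\<And>x. \<bar>f x\<bar> \<le> 1" by blast
      define I where "I = pairs_upto n"
      have finI: "finite I" unfolding I_def by (rule finite_pairs_upto)
      have An: "A i \<subseteq> {1..n}" if "i < q" for i
      proof -
        have "(i + 1) * D \<le> q * D" using that by (intro mult_right_mono) auto
        then show ?thesis unfolding A_def using n by auto
      qed
      have EI: "E i \<subseteq> I" if "i < q" for i
        unfolding E_def I_def pairs_upto_def using An[OF that] by (rule le2_subsets_mono)
      have Adisj: "A i \<inter> A j = {}" if "i < j" for i j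
      proof -
        have "(i + 1) * D \<le> j * D" using that by (intro mult_right_mono) auto
        then show ?thesis unfolding A_def by auto
      qed
      have Edisj: "E i \<inter> E j = {}" if "i \<noteq> j" for i j
      proof -
        have "A i \<inter> A j = {}" using Adisj[of i j] Adisj[of j i] that by (cases "i < j") auto
        then show ?thesis unfolding E_def le2_subsets_def by auto
      qed
      have "\<exists>i\<in>{..<q}. avg (lists_of k (Pow I)) (\<lambda>Y. cond_var I (E i) (mult_derivs Y f)) + cond_var I (E i) f
          \<le> 2 / real (card {..<q})"
        by (rule exists_low_variance_block)
          (use finI q f EI Edisj finite_lists_of[of "Pow I" k] lists_of_nonempty[of "{}" "Pow I" k]
            in \<open>auto intro: mult_derivs_bounded\<close>)
      then obtain i where i: "i < q" and
        V: "avg (lists_of k (Pow I)) (\<lambda>Y. cond_var I (E i) (mult_derivs Y f)) + cond_var I (E i) f \<le> 2 / real q" by auto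
      have V1: "avg (lists_of k (Pow I)) (\<lambda>Y. cond_var I (E i) (mult_derivs Y f)) \<le> 2 / real q"
        using V cond_var_nonneg[of I "E i" f] by linarith
      have "0 \<le> avg (lists_of k (Pow I)) (\<lambda>Y. cond_var I (E i) (mult_derivs Y f))"
        by (intro avg_nonneg cond_var_nonneg)
      then have V2: "cond_var I (E i) f \<le> 2 / real q" using V by linarith
      have "(2 ^ card (E i)) ^ k * real R ^ k * (2 ^ card (E i) * (2 / real q) / c0\<^sup>2) \<le>
          K ^ k * real R ^ k * (K * (2 / real q) / c0\<^sup>2)"
        by (intro mult_mono power_mono divide_right_mono cE) (use K in auto)
      also have "\<dots> = K ^ k * real R ^ k * (K * 2 / c0\<^sup>2) / real q" by simp
      also have "\<dots> < 1"
      proof -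
        have "0 < K * 2 / \<gamma>\<^sup>2 + 1" using K \<gamma> by (intro add_pos_pos) auto
        then have "K ^ k * real R ^ k * (K * 2 / c0\<^sup>2) < real q" using q unfolding Z_def by linarith
        then show ?thesis using q(2) by (simp only: divide_less_eq_1_pos of_nat_0_less_iff)
      qed
      finally have small: "(2 ^ card (E i)) ^ k * real R ^ k * (2 ^ card (E i) * (2 / real q) / c0\<^sup>2) < 1" .
      obtain \<tau> where \<tau>: "\<tau> \<in> lists_of k (Pow I)" and
        good: "\<And>vs ls p. vs \<in> lists_of k (Pow (E i)) \<Longrightarrow> ls \<in> lists_of k {..<R} \<Longrightarrow> p \<in> Pow (E i) \<Longrightarrow>
          \<bar>cond_avg I (E i) (mult_derivs (corrected I R \<epsilon> f (map2 (\<oplus>) vs \<tau>) ls) f) p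
            - avg (Pow I) (mult_derivs (corrected I R \<epsilon> f (map2 (\<oplus>) vs \<tau>) ls) f)\<bar> \<le> c0"
        using exists_generic_shift[OF finI EI[OF i] c0 V1 small] by blast
      define Av where "Av vs ls = avg (Pow I) (mult_derivs (corrected I R \<epsilon> f (map2 (\<oplus>) vs \<tau>) ls) f)" for vs ls
      have "\<exists>ls. ls \<in> lists_of k {..<R} \<and> 2 * c0 \<le> \<bar>Av vs ls\<bar>" if vs: "vs \<in> lists_of k (Pow (E i))" for vs
      proof -
        have len: "length (map2 (\<oplus>) vs \<tau>) = k" using vs \<tau> by (simp add: lists_of_def)
        have "map2 (\<oplus>) vs \<tau> \<in> lists_of k (Pow I)"
          using vs \<tau> EI[OF i] lists_of_mono[of vs k "Pow (E i)" "Pow I"]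
          by (intro map2_symdiff_in_lists_of) auto
        then have "set (map2 (\<oplus>) vs \<tau>) \<subseteq> Pow I" unfolding lists_of_def by blast
        then have "\<exists>ls. length ls = length (map2 (\<oplus>) vs \<tau>) \<and> set ls \<subseteq> {..<R} \<and>
            \<epsilon> / 2 ^ length (map2 (\<oplus>) vs \<tau>) \<le> (Av vs ls)\<^sup>2"
          unfolding Av_def by (intro corrected_large finI f \<epsilon>) (use g R in \<open>simp_all only: len I_def\<close>)
        then obtain ls where ls: "ls \<in> lists_of k {..<R}" "\<epsilon> / 2 ^ k \<le> (Av vs ls)\<^sup>2"
          unfolding len lists_of_def by blast
        have "2 * c0 \<le> \<bar>Av vs ls\<bar>"
          unfolding c0_def using real_sqrt_le_mono[OF ls(2)] by simp
        then show ?thesis using ls(1) by blast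
      qed
      then obtain lsf where lsf: "\<And>vs. vs \<in> lists_of k (Pow (E i)) \<Longrightarrow> lsf vs \<in> lists_of k {..<R}"
        "\<And>vs. vs \<in> lists_of k (Pow (E i)) \<Longrightarrow> 2 * c0 \<le> \<bar>Av vs (lsf vs)\<bar>" by metis
      \<comment> \<open>The sign belongs to the colour so that the means do not cancel when averaged
        over the structure.\<close>
      define col where "col vs = (lsf vs, if 0 \<le> Av vs (lsf vs) then 1 else - 1 :: real)" for vs
      \<comment> \<open>Positions in the block are counted from 0. The quotient by \<open>M\<close>
        is the base point below \<open>N\<close>; the remainder plus 1 is the vertex of
        \<open>{1..M}\<close>.\<close>
      define \<beta> where "\<beta> v = (v - 1 - i * D) div M" for v
      define w where "w v = (v - 1 - i * D) mod M + 1" for v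
      have colX: "\<forall>vs\<in>lists_of k (Pow (le2_subsets (A i))). col vs \<in> X"
        using lsf(1) unfolding col_def X_def E_def by auto
      have "finite (A i)" unfolding A_def by simp
      from N[THEN spec, THEN spec, THEN spec, THEN spec, THEN mp, OF this, THEN mp, OF colX, of \<beta> w]
      obtain z B where z: "z \<in> lists_of k (Pow (E i))" and B: "B \<subseteq> {..<N}" "B \<noteq> {}" and
        mono: "\<And>us. us \<in> lists_of k (Pow (pairs_upto M)) \<Longrightarrow>
          col (map2 (\<oplus>) z (map (blowup {v\<in>A i. \<beta> v \<in> B} w) us)) = col z"
        unfolding E_def by blast
      define S where "S = {v\<in>A i. \<beta> v \<in> B}"
      have SA: "S \<subseteq> A i" unfolding S_def by auto
      have wS: "w ` S = {1..M}"
      proof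
        show "w ` S \<subseteq> {1..M}" unfolding w_def using M by (auto simp: Suc_le_eq)
        show "{1..M} \<subseteq> w ` S"
        proof
          fix j assume j: "j \<in> {1..M}"
          \<comment> \<open>One element of \<open>B\<close> carries a copy of every
            \<open>j\<close>, so nonemptiness of \<open>B\<close> makes \<open>w\<close> map
            \<open>S\<close> onto \<open>{1..M}\<close>.\<close>
          obtain b where b: "b \<in> B" "b < N" using B by auto
          define v where "v = i * D + b * M + j"
          have v: "v - 1 - i * D = b * M + (j - 1)" "j - 1 < M" unfolding v_def using j by auto
          have "b * M + M \<le> N * M" using b(2) by (metis Suc_leI add.commute mult_Suc mult_le_mono1)
          then have "v \<in> A i" unfolding A_def v_def D_def using j by auto
          moreover have "\<beta> v = b" unfolding \<beta>_def v(1) using v(2) by simp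
          moreover have "w v = j"
          proof -
            have "(b * M + t) mod M = t" if "t < M" for t using that by simp
            then have "w v = j - 1 + 1" unfolding w_def v(1) using v(2) by presburger
            then show ?thesis using j by simp
          qed
          ultimately show "j \<in> w ` S" unfolding S_def using b by force
        qed
      qed
      have SE: "le2_subsets S \<subseteq> E i" unfolding E_def using SA by (rule le2_subsets_mono)
      have \<theta>E: "blowup S w u \<subseteq> E i" for u using blowup_subset[of S w u] SE by simp
      obtain ls \<sigma> where colz: "col z = (ls, \<sigma>)" by (cases "col z")
      have ls: "ls \<in> lists_of k {..<R}" and \<sigma>: "\<bar>\<sigma>\<bar> = 1"
        using colz lsf(1)[OF z] unfolding col_def by auto
      have large: "c0 \<le> \<sigma> * cond_avg I (E i) (mult_derivs (corrected I R \<epsilon> f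
          (map2 (\<oplus>) (map2 (\<oplus>) z (map (blowup S w) us)) \<tau>) ls) f) p"
        if us: "us \<in> lists_of k (Pow (pairs_upto M))" and p: "p \<in> Pow (E i)" for us p
      proof -
        define vs where "vs = map2 (\<oplus>) z (map (blowup S w) us)"
        have vs: "vs \<in> lists_of k (Pow (E i))"
          unfolding vs_def
          by (rule map2_symdiff_in_lists_of) (use z us \<theta>E in \<open>auto simp: lists_of_def\<close>)
        have cv: "col vs = (ls, \<sigma>)" using mono[OF us] colz unfolding vs_def S_def by simp
        then have "2 * c0 \<le> \<sigma> * Av vs ls"
          using lsf(2)[OF vs] unfolding col_def by (auto split: if_splits)
        moreover have "\<bar>cond_avg I (E i) (mult_derivs (corrected I R \<epsilon> f (map2 (\<oplus>) vs \<tau>) ls) f) p - Av vs ls\<bar> \<le> c0"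
          using good[OF vs ls p] unfolding Av_def .
        moreover have "\<sigma> = 1 \<or> \<sigma> = - 1" using \<sigma> by linarith
        ultimately show ?thesis unfolding vs_def by (elim disjE) (simp_all add: abs_le_iff)
      qed
      have res1: "c0 ^ (2 ^ k) \<le>
          avg (Pow (I - E i)) (\<lambda>x. gowers_pow (pairs_upto M) k (\<lambda>u. f (x \<oplus> blowup S w u)))"
      proof (rule gowers_pow_planted_ge[OF finI finite_pairs_upto EI[OF i] blowup_symdiff \<theta>E f k])
        show "0 \<le> c0" using c0 by simp
        show "length z = k" "length \<tau> = k" "length ls = k" using z \<tau> ls by (auto simp: lists_of_def)
        show "\<bar>\<sigma>\<bar> = 1" by (rule \<sigma>)
      qed (rule large)
      have cf: "avg (Pow I) f - \<gamma> \<le> cond_avg I (E i) f p" if p: "p \<in> Pow (E i)" for p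
      proof -
        have "(cond_avg I (E i) f p - avg (Pow I) f)\<^sup>2 \<le> 2 ^ card (E i) * cond_var I (E i) f"
          by (rule cond_avg_deviation_le[OF finI EI[OF i] p])
        also have "\<dots> \<le> K * (2 / real q)"
          by (intro mult_mono cE V2 cond_var_nonneg) (use K in auto)
        also have "\<dots> \<le> \<gamma>\<^sup>2"
        proof -
          have "0 \<le> K ^ k * real R ^ k * (K * 2 / c0\<^sup>2)" using K by simp
          then have "K * 2 / \<gamma>\<^sup>2 \<le> real q" using q unfolding Z_def by linarith
          then show ?thesis using q(2) \<gamma> by (simp add: field_simps)
        qed
        finally have "\<bar>cond_avg I (E i) f p - avg (Pow I) f\<bar> \<le> \<gamma>"
          using \<gamma> by (metis abs_le_square_iff abs_of_pos)
        then show ?thesis by linarith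
      qed
      have "avg (Pow I) f - \<gamma> = avg (Pow (pairs_upto M)) (\<lambda>u. avg (Pow I) f - \<gamma>)"
        using avg_const_Pow[OF finite_pairs_upto] by simp
      also have "\<dots> \<le> avg (Pow (pairs_upto M)) (\<lambda>u. cond_avg I (E i) f (blowup S w u))"
        by (intro avg_mono cf) (use \<theta>E in auto)
      also have "\<dots> = avg (Pow (I - E i)) (\<lambda>x. avg (Pow (pairs_upto M)) (\<lambda>u. f (x \<oplus> blowup S w u)))"
        unfolding cond_avg_def by (subst avg_swap) (simp add: symdiff_commute)
      finally have res2: "avg (Pow I) f - \<gamma> \<le>
          avg (Pow (I - E i)) (\<lambda>x. avg (Pow (pairs_upto M)) (\<lambda>u. f (x \<oplus> blowup S w u)))" .
      show "blowup_with n M k (c0 ^ (2 ^ k)) \<gamma> f"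
        unfolding blowup_with_def
        using SA An[OF i] wS EI[OF i] SE res1 res2 unfolding I_def
        by (intro exI[of _ S] exI[of _ w] exI[of _ "E i"] conjI) auto
    qed
  qed
qed

section \<open>Codes\<close>

lemma vset_le2_subsets: "vset (le2_subsets T) = T"
proof -
  have "{x} \<in> le2_subsets T" if "x \<in> T" for x using that unfolding le2_subsets_def by simp
  then show ?thesis unfolding vset_def le2_subsets_def by auto
qed

lemma pair_in_le2_subsets: "{x, y} \<in> le2_subsets T \<longleftrightarrow> x \<in> T \<and> y \<in> T"
  unfolding le2_subsets_def by (auto simp: card_insert_if)

lemma graph_iso_Kloop_le2_subsets:
  assumes "finite T"
  shows "graph_iso (le2_subsets T) (Kloop (card T))"
proof -
  obtain \<phi> where \<phi>: "bij_betw \<phi> T {1..card T}" using ex_bij_betw_nat_finite_1[OF assms] bij_betw_inv by blast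
  then show ?thesis unfolding graph_iso_def Kloop_def vset_le2_subsets pair_in_le2_subsets
    by (intro exI[of _ \<phi>]) (auto dest: bij_betwE)
qed

text \<open>The isomorphism forces all pairs and loops on \<open>vset G\<close> into
  \<open>G\<close>, and \<open>G \<subseteq> pairs_upto M\<close> rules out anything else. Forbidden
  differences thus become concrete sets \<open>le2_subsets T\<close>.\<close>

lemma le2_subsets_of_graph_iso_Kloop:
  assumes iso: "graph_iso G (Kloop r)" and r: "1 \<le> r" and G: "G \<subseteq> pairs_upto M"
  shows "\<exists>T. T \<noteq> {} \<and> T \<subseteq> {1..M} \<and> G = le2_subsets T"
proof (intro exI[of _ "vset G"] conjI)
  obtain \<phi> where \<phi>: "bij_betw \<phi> (vset G) {1..r}" and
    e: "\<And>x y. x \<in> vset G \<Longrightarrow> y \<in> vset G \<Longrightarrow> {x, y} \<in> G \<longleftrightarrow> {\<phi> x, \<phi> y} \<in> le2_subsets {1..r}"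
    using iso unfolding graph_iso_def Kloop_def vset_le2_subsets by blast
  show "vset G \<noteq> {}" using \<phi> r by (auto simp: bij_betw_def)
  show M: "vset G \<subseteq> {1..M}" using G unfolding vset_def pairs_upto_def le2_subsets_def by auto
  show "G = le2_subsets (vset G)"
  proof
    show "G \<subseteq> le2_subsets (vset G)" using G unfolding vset_def pairs_upto_def le2_subsets_def by auto
    show "le2_subsets (vset G) \<subseteq> G"
    proof
      fix a assume a: "a \<in> le2_subsets (vset G)"
      then have "finite a" "a \<noteq> {}" "card a \<le> 2" "a \<subseteq> vset G"
        using M finite_subset[of a "{1..M}"] unfolding le2_subsets_def by auto
      then have "card a = 1 \<or> card a = 2" by (metis card_0_eq le_Suc_eq le_zero_eq numeral_2_eq_2 One_nat_def)
      then obtain x y where xy: "a = {x, y}" by (metis card_1_singletonE card_2_iff insert_absorb2)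
      then have "x \<in> vset G" "y \<in> vset G" using \<open>a \<subseteq> vset G\<close> by auto
      then show "a \<in> G" unfolding xy e[OF \<open>x \<in> vset G\<close> \<open>y \<in> vset G\<close>] pair_in_le2_subsets
        using \<phi> by (auto dest: bij_betwE)
    qed
  qed
qed

lemma blowup_le2_subsets:
  assumes "finite S"
  shows "blowup S w (le2_subsets T) = le2_subsets {v\<in>S. w v \<in> T}"
proof -
  have "card (w ` e) \<le> 2" if "e \<subseteq> S" "card e \<le> 2" for e
    using card_image_le[of e w] that finite_subset[OF _ assms] by fastforce
  then show ?thesis unfolding blowup_def le2_subsets_def by auto
qed

definition pullback :: "nat set \<Rightarrow> (nat \<Rightarrow> nat) \<Rightarrow> nat \<Rightarrow> nat set set \<Rightarrow> nat set set set \<Rightarrow> nat set set set" where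
  "pullback S w M x \<G> = {u \<in> Pow (pairs_upto M). x \<oplus> blowup S w u \<in> \<G>}"

text \<open>A forbidden difference on \<open>T\<close> blows up to a forbidden difference on the
  preimage of \<open>T\<close>, which is nonempty because \<open>w\<close> is onto.\<close>

lemma HJ_code_pullback:
  assumes code: "HJ_code \<G>" and S: "finite S" "w ` S = {1..M}" and x: "x \<inter> le2_subsets S = {}"
  shows "HJ_code (pullback S w M x \<G>)"
  unfolding HJ_code_def
proof (intro ballI impI)
  fix u1 u2 assume u: "u1 \<in> pullback S w M x \<G>" "u2 \<in> pullback S w M x \<G>" "u2 \<subseteq> u1"
  show "\<not> (\<exists>K\<in>Cloop. graph_iso (u1 \<oplus> u2) K)"
  proof
    assume "\<exists>K\<in>Cloop. graph_iso (u1 \<oplus> u2) K"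
    then obtain r where r: "1 \<le> r" "graph_iso (u1 \<oplus> u2) (Kloop r)" unfolding Cloop_def by auto
    have "u1 \<oplus> u2 \<subseteq> pairs_upto M" using u unfolding pullback_def symdiff_def by auto
    from le2_subsets_of_graph_iso_Kloop[OF r(2,1) this]
    obtain T where T: "T \<noteq> {}" "T \<subseteq> {1..M}" "u1 \<oplus> u2 = le2_subsets T" by blast
    define T' where "T' = {v\<in>S. w v \<in> T}"
    have T': "finite T'" "T' \<noteq> {}"
    proof -
      show "finite T'" unfolding T'_def using S(1) by simp
      obtain t where t: "t \<in> T" using T(1) by blast
      then have "t \<in> w ` S" using S(2) T(2) by blast
      then show "T' \<noteq> {}" unfolding T'_def using t by blast
    qed
    let ?x = "\<lambda>u. x \<oplus> blowup S w u"
    have "?x u1 \<oplus> ?x u2 = blowup S w (u1 \<oplus> u2)" by (simp add: blowup_symdiff symdiff_ac)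
    then have eq: "?x u1 \<oplus> ?x u2 = le2_subsets T'"
      unfolding T(3) T'_def by (simp add: blowup_le2_subsets[OF S(1)])
    have "blowup S w u2 \<subseteq> blowup S w u1" using u(3) unfolding blowup_def by auto
    \<comment> \<open>\<open>x\<close> is disjoint from both blow-ups, so adding it is a disjoint
      union and preserves inclusion.\<close>
    then have "?x u2 \<subseteq> ?x u1" using x blowup_subset[of S w u1] unfolding symdiff_def by blast
    moreover have "?x u1 \<in> \<G>" "?x u2 \<in> \<G>" using u unfolding pullback_def by auto
    moreover have "Kloop (card T') \<in> Cloop" unfolding Cloop_def
      using T' by (auto simp: Suc_le_eq card_gt_0_iff)
    moreover have "graph_iso (?x u1 \<oplus> ?x u2) (Kloop (card T'))"
      unfolding eq by (rule graph_iso_Kloop_le2_subsets[OF T'(1)])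
    ultimately show False using code unfolding HJ_code_def by metis
  qed
qed

lemma avg_indicator_eq_prob:
  assumes "\<G> \<subseteq> Pow (pairs_upto n)"
  shows "avg (Pow (pairs_upto n)) (\<lambda>x. indicator \<G> x - a) = prob_n n \<G> - a"
proof -
  have "avg (Pow (pairs_upto n)) (indicator \<G>) = prob_n n \<G>"
  proof -
    have fin: "finite (Pow (pairs_upto n))" using finite_pairs_upto[of n] by simp
    have "(\<Sum>x\<in>Pow (pairs_upto n). indicator \<G> x) = (\<Sum>x\<in>Pow (pairs_upto n). if x \<in> \<G> then 1 else 0 :: real)"
      by (intro sum.cong) (simp_all add: indicator_def)
    also have "\<dots> = real (card (Pow (pairs_upto n) \<inter> \<G>))"
      using sum.inter_restrict[OF fin, of "\<lambda>_. 1 :: real" \<G>] by simp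
    finally show ?thesis unfolding avg_def prob_n_def
      using finite_pairs_upto[of n] by (simp add: card_Pow Int_commute)
  qed
  then show ?thesis by (simp add: avg_diff avg_const_Pow[OF finite_pairs_upto])
qed

lemma finite_codes: "finite (prob_n n ` {\<G>. \<G> \<subseteq> Pow (pairs_upto n) \<and> HJ_code \<G>})"
  
proof (rule finite_imageI, rule finite_subset)
  show "{\<G>. \<G> \<subseteq> Pow (pairs_upto n) \<and> HJ_code \<G>} \<subseteq> Pow (Pow (pairs_upto n))" by auto
qed (simp add: finite_pairs_upto)

lemma prob_le_Delta: "\<G> \<subseteq> Pow (pairs_upto n) \<Longrightarrow> HJ_code \<G> \<Longrightarrow> prob_n n \<G> \<le> Delta_loop n"
  unfolding Delta_loop_def by (intro Max_ge finite_codes) auto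

lemma Delta_nonneg: "0 \<le> Delta_loop n"
proof -
  have "prob_n n {} \<le> Delta_loop n" by (rule prob_le_Delta) (auto simp: HJ_code_def)
  then show ?thesis unfolding prob_n_def by simp
qed

text \<open>Fixing the edges that do not lie inside \<open>{1..m}\<close> splits a code into codes
  on \<open>m\<close> vertices, and its density is the average of theirs.\<close>

lemma Delta_antimono:
  assumes "m \<le> n"
  shows "Delta_loop n \<le> Delta_loop m"
proof -
  have "{} \<in> {\<G>. \<G> \<subseteq> Pow (pairs_upto n) \<and> HJ_code \<G>}" by (simp add: HJ_code_def)
  then have ne: "prob_n n ` {\<G>. \<G> \<subseteq> Pow (pairs_upto n) \<and> HJ_code \<G>} \<noteq> {}" by blast
  have "Delta_loop n \<in> prob_n n ` {\<G>. \<G> \<subseteq> Pow (pairs_upto n) \<and> HJ_code \<G>}"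
    unfolding Delta_loop_def by (rule Max_in[OF finite_codes ne])
  then obtain \<G> where G: "\<G> \<subseteq> Pow (pairs_upto n)" "HJ_code \<G>" "Delta_loop n = prob_n n \<G>"
    by (elim imageE CollectE conjE)
  have sub: "pairs_upto m \<subseteq> pairs_upto n"
    unfolding pairs_upto_def using assms by (intro le2_subsets_mono) auto
  have id: "blowup {1..m} id p = p" if "p \<in> Pow (pairs_upto m)" for p
    using that unfolding blowup_def pairs_upto_def by auto
  have "prob_n n \<G> = avg (Pow (pairs_upto n)) (\<lambda>x. indicator \<G> x - 0)"
    using avg_indicator_eq_prob[OF G(1), of 0] by simp
  also have "\<dots> = avg (Pow (pairs_upto n - pairs_upto m)) (\<lambda>x. avg (Pow (pairs_upto m)) (\<lambda>p. indicator \<G> (p \<oplus> x) - 0))"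
    by (subst avg_Pow_split[OF sub]) (rule avg_swap)
  also have "\<dots> \<le> avg (Pow (pairs_upto n - pairs_upto m)) (\<lambda>x. Delta_loop m)"
  proof (rule avg_mono)
    fix x assume x: "x \<in> Pow (pairs_upto n - pairs_upto m)"
    have "avg (Pow (pairs_upto m)) (\<lambda>p. indicator \<G> (p \<oplus> x) - 0) =
        avg (Pow (pairs_upto m)) (\<lambda>p. indicator (pullback {1..m} id m x \<G>) p - 0)"
      by (intro avg_cong) (use id in \<open>auto simp: pullback_def indicator_def symdiff_commute\<close>)
    also have "\<dots> = prob_n m (pullback {1..m} id m x \<G>)"
      by (subst avg_indicator_eq_prob) (auto simp: pullback_def)
    also have "\<dots> \<le> Delta_loop m"
      by (intro prob_le_Delta HJ_code_pullback G) (use x in \<open>auto simp: pullback_def pairs_upto_def\<close>)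
    finally show "avg (Pow (pairs_upto m)) (\<lambda>p. indicator \<G> (p \<oplus> x) - 0) \<le> Delta_loop m" .
  qed
  also have "\<dots> = Delta_loop m" by (rule avg_const_Pow) (simp add: finite_pairs_upto)
  finally show ?thesis using G(3) by simp
qed

text \<open>The reference density \<open>a\<close> stays fixed along the induction while the codes
  change, so it is only required to be close to their densities. \<open>\<eta>\<close> precedes
  \<open>m0\<close> because in the end \<open>m0\<close> is chosen with \<open>Delta_loop m0\<close>
  within \<open>\<eta>\<close> of the infimum.\<close>

lemma dense_code_gowers_pow_small:
  "0 < \<epsilon> \<Longrightarrow> \<exists>\<eta>>0. \<forall>m0. \<exists>n0. \<forall>n\<ge>n0. \<forall>a \<G>. 0 \<le> a \<longrightarrow> a \<le> 1 \<longrightarrow> \<G> \<subseteq> Pow (pairs_upto n) \<longrightarrow>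
    HJ_code \<G> \<longrightarrow> Delta_loop m0 \<le> a + \<eta> \<longrightarrow> a - \<eta> \<le> prob_n n \<G> \<longrightarrow>
    gowers_pow (pairs_upto n) (Suc k) (\<lambda>x. indicator \<G> x - a) < \<epsilon>"
proof (induction k arbitrary: \<epsilon>)
  case 0
  define \<eta> where "\<eta> = sqrt \<epsilon> / 2"
  have \<eta>: "0 < \<eta>" "\<eta>\<^sup>2 < \<epsilon>" unfolding \<eta>_def using 0 by (auto simp: power_divide)
  have small: "gowers_pow (pairs_upto n) (Suc 0) (\<lambda>x. indicator \<G> x - a) < \<epsilon>"
    if n: "m0 \<le> n" and G: "\<G> \<subseteq> Pow (pairs_upto n)" "HJ_code \<G>" and
      D: "Delta_loop m0 \<le> a + \<eta>" and p: "a - \<eta> \<le> prob_n n \<G>" for m0 n a \<G>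
  proof -
    have "prob_n n \<G> \<le> a + \<eta>" using prob_le_Delta[OF G] Delta_antimono[OF n] D by linarith
    then have "\<bar>prob_n n \<G> - a\<bar> \<le> \<bar>\<eta>\<bar>" using p \<eta> by linarith
    then have "(prob_n n \<G> - a)\<^sup>2 \<le> \<eta>\<^sup>2" by (simp only: abs_le_square_iff)
    then show ?thesis using \<eta> unfolding gowers_pow_1 avg_indicator_eq_prob[OF G(1)] by linarith
  qed
  show ?case
  proof (intro exI[of _ \<eta>] conjI allI \<eta>(1))
    fix m0
    show "\<exists>n0. \<forall>n\<ge>n0. \<forall>a \<G>. 0 \<le> a \<longrightarrow> a \<le> 1 \<longrightarrow> \<G> \<subseteq> Pow (pairs_upto n) \<longrightarrow>
      HJ_code \<G> \<longrightarrow> Delta_loop m0 \<le> a + \<eta> \<longrightarrow> a - \<eta> \<le> prob_n n \<G> \<longrightarrow>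
      gowers_pow (pairs_upto n) (Suc 0) (\<lambda>x. indicator \<G> x - a) < \<epsilon>"
      by (intro exI[of _ m0] allI impI small)
  qed
next
  case (Suc k)
  obtain c where c: "0 < c" and low: "\<And>M \<gamma>. 0 < M \<Longrightarrow> 0 < \<gamma> \<Longrightarrow> (\<exists>n0. \<forall>n\<ge>n0. \<forall>f. (\<forall>x. \<bar>f x\<bar> \<le> 1) \<longrightarrow>
    \<epsilon> \<le> gowers_pow (pairs_upto n) (Suc (Suc k)) f \<longrightarrow>
    blowup_with n M (Suc k) c \<gamma> f)"
    using gowers_pow_degree_lowering[of "Suc k" \<epsilon>] Suc.prems by blast
  obtain \<eta>1 where \<eta>1: "0 < \<eta>1" and IH: "\<And>m0. \<exists>n0. \<forall>n\<ge>n0. \<forall>a \<G>. 0 \<le> a \<longrightarrow> a \<le> 1 \<longrightarrow> \<G> \<subseteq> Pow (pairs_upto n) \<longrightarrow>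
    HJ_code \<G> \<longrightarrow> Delta_loop m0 \<le> a + \<eta>1 \<longrightarrow> a - \<eta>1 \<le> prob_n n \<G> \<longrightarrow>
    gowers_pow (pairs_upto n) (Suc k) (\<lambda>x. indicator \<G> x - a) < c / 2"
    using Suc.IH[of "c / 2"] c by auto
  \<comment> \<open>The bound \<open>4 * \<eta> \<le> \<eta>1\<close> keeps the density of the
    selected code above \<open>a - \<eta>1\<close>; the bound
    \<open>12 * \<eta> \<le> c * \<eta>1\<close> contradicts the final inequality
    \<open>\<eta>1 * c / 2 < 6 * \<eta>\<close>.\<close>
  define \<eta> where "\<eta> = min (\<eta>1 / 4) (c * \<eta>1 / 12)"
  have \<eta>: "0 < \<eta>" "4 * \<eta> \<le> \<eta>1" "12 * \<eta> \<le> c * \<eta>1" unfolding \<eta>_def using \<eta>1 c by auto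
  show ?case
  proof (intro exI[of _ \<eta>] conjI allI \<eta>(1))
    fix m0
    from IH[of m0] obtain n1 where n1: "\<forall>n\<ge>n1. \<forall>a \<G>. 0 \<le> a \<longrightarrow> a \<le> 1 \<longrightarrow> \<G> \<subseteq> Pow (pairs_upto n) \<longrightarrow>
      HJ_code \<G> \<longrightarrow> Delta_loop m0 \<le> a + \<eta>1 \<longrightarrow> a - \<eta>1 \<le> prob_n n \<G> \<longrightarrow>
      gowers_pow (pairs_upto n) (Suc k) (\<lambda>x. indicator \<G> x - a) < c / 2" ..
    \<comment> \<open>\<open>m0 \<le> M\<close> bounds the densities of planted codes by
      \<open>Delta_loop m0\<close>, and \<open>n1 \<le> M\<close> makes the induction hypothesis
      available for them.\<close>
    define M where "M = max 1 (max m0 n1)"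
    have M: "0 < M" "m0 \<le> M" "n1 \<le> M" unfolding M_def by auto
    obtain n0 where n0: "\<forall>n\<ge>n0. \<forall>f. (\<forall>x. \<bar>f x\<bar> \<le> 1) \<longrightarrow>
    \<epsilon> \<le> gowers_pow (pairs_upto n) (Suc (Suc k)) f \<longrightarrow>
    blowup_with n M (Suc k) c \<eta> f"
      using low[OF M(1) \<eta>(1)] by blast
    show "\<exists>n0. \<forall>n\<ge>n0. \<forall>a \<G>. 0 \<le> a \<longrightarrow> a \<le> 1 \<longrightarrow> \<G> \<subseteq> Pow (pairs_upto n) \<longrightarrow>
      HJ_code \<G> \<longrightarrow> Delta_loop m0 \<le> a + \<eta> \<longrightarrow> a - \<eta> \<le> prob_n n \<G> \<longrightarrow>
      gowers_pow (pairs_upto n) (Suc (Suc k)) (\<lambda>x. indicator \<G> x - a) < \<epsilon>"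
    proof (intro exI[of _ n0] allI impI, rule ccontr)
      fix n a \<G>
      assume n: "n0 \<le> n" and a: "0 \<le> (a::real)" "a \<le> 1" and G: "\<G> \<subseteq> Pow (pairs_upto n)" "HJ_code \<G>"
        and D: "Delta_loop m0 \<le> a + \<eta>" and p: "a - \<eta> \<le> prob_n n \<G>"
        and "\<not> gowers_pow (pairs_upto n) (Suc (Suc k)) (\<lambda>x. indicator \<G> x - a) < \<epsilon>"
      then have g: "\<epsilon> \<le> gowers_pow (pairs_upto n) (Suc (Suc k)) (\<lambda>x. indicator \<G> x - a)" by simp
      define f where "f x = indicator \<G> x - a" for x
      have f: "\<bar>f x\<bar> \<le> 1" for x unfolding f_def using a by (auto simp: indicator_def)
      have bw: "blowup_with n M (Suc k) c \<eta> f"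
        by (rule n0[rule_format, OF n f]) (use g in \<open>simp only: f_def[abs_def]\<close>)
      obtain S w E where S: "S \<subseteq> {1..n}" "w ` S = {1..M}" and E: "le2_subsets S \<subseteq> E" and
        g1: "c \<le> avg (Pow (pairs_upto n - E)) (\<lambda>x. gowers_pow (pairs_upto M) (Suc k) (\<lambda>u. f (x \<oplus> blowup S w u)))" and
        h1: "avg (Pow (pairs_upto n)) f - \<eta> \<le>
          avg (Pow (pairs_upto n - E)) (\<lambda>x. avg (Pow (pairs_upto M)) (\<lambda>u. f (x \<oplus> blowup S w u)))"
        using bw unfolding blowup_with_def by blast
      define gg where "gg x = gowers_pow (pairs_upto M) (Suc k) (\<lambda>u. f (x \<oplus> blowup S w u))" for x
      define hh where "hh x = avg (Pow (pairs_upto M)) (\<lambda>u. f (x \<oplus> blowup S w u))" for x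
      define P where "P x = pullback S w M x \<G>" for x
      have fP: "f (x \<oplus> blowup S w u) = indicator (P x) u - a" if "u \<in> Pow (pairs_upto M)" for x u
        using that unfolding f_def P_def pullback_def by (auto simp: indicator_def)
      have PM: "P x \<subseteq> Pow (pairs_upto M)" for x unfolding P_def pullback_def by auto
      have gg: "gg x = gowers_pow (pairs_upto M) (Suc k) (\<lambda>u. indicator (P x) u - a)" for x
        unfolding gg_def by (rule gowers_pow_cong) (rule fP)
      have hh: "hh x = prob_n M (P x) - a" for x
        unfolding hh_def avg_indicator_eq_prob[OF PM, symmetric] by (intro avg_cong fP)
      have code: "HJ_code (P x)" if "x \<in> Pow (pairs_upto n - E)" for x
        unfolding P_def using S E that finite_subset[OF S(1)] by (intro HJ_code_pullback G) auto
      have hle: "hh x \<le> \<eta>" if "x \<in> Pow (pairs_upto n - E)" for x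
        unfolding hh using prob_le_Delta[OF PM code[OF that]] Delta_antimono[OF M(2)] D by linarith
      have h2: "- 2 * \<eta> \<le> avg (Pow (pairs_upto n - E)) hh"
        using h1 p unfolding f_def[abs_def] avg_indicator_eq_prob[OF G(1)] hh_def[abs_def] f_def by linarith
      \<comment> \<open>The weights let one \<open>x\<close> serve twice: with the trivial bound
        \<open>gg x \<le> 1\<close> the inequality shows that the density is high enough for the
        induction hypothesis, and then with \<open>gg x < c / 2\<close> it fails.\<close>
      have "avg (Pow (pairs_upto n - E)) (\<lambda>x. \<eta>1 * gg x + 2 * hh x) \<ge> \<eta>1 * c - 4 * \<eta>"
        using mult_left_mono[OF g1, of \<eta>1] h2 \<eta>1 unfolding avg_add avg_cmult gg_def[symmetric] by linarith
      from avg_ge_ex[OF _ _ this] finite_pairs_upto[of n]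
      obtain x where x: "x \<in> Pow (pairs_upto n - E)" and ge: "\<eta>1 * c - 4 * \<eta> \<le> \<eta>1 * gg x + 2 * hh x" by auto
      have "gg x \<le> 1" unfolding gg_def using gowers_pow_le_1[of "\<lambda>u. f (x \<oplus> blowup S w u)"] f
        by (simp only: abs_le_iff)
      then have "\<eta>1 * gg x \<le> \<eta>1 * 1" using \<eta>1 by (intro mult_left_mono) auto
      then have "\<eta>1 * c - 4 * \<eta> - \<eta>1 \<le> 2 * hh x" using ge by simp
      then have "- \<eta>1 \<le> hh x" using \<eta> c \<eta>1 mult_pos_pos[OF \<eta>1 c] by linarith
      then have "gg x < c / 2" unfolding gg using D \<eta> \<eta>1
        by (intro n1[rule_format, OF M(3) a PM code[OF x]]) (auto simp: hh)
      then have "\<eta>1 * gg x < \<eta>1 * (c / 2)" using \<eta>1 by (intro mult_strict_left_mono) auto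
      then show False using ge hle[OF x] \<eta>(3) by (simp add: mult.commute)
    qed
  qed
qed

section \<open>The Gowers norm\<close>

lemma sdsum_insort: "sdsum (map g (insort a xs)) = g a \<oplus> sdsum (map g xs)"
  by (induction xs) (simp_all add: symdiff_left_commute)

lemma mult_derivs_eq_prod:
  "mult_derivs ys f x = (\<Prod>s\<in>Pow {..<length ys}. f (x \<oplus> sdsum (map (\<lambda>i. ys ! i) (sorted_list_of_set s))))"
proof (induction ys arbitrary: x rule: rev_induct)
  case (snoc y ys)
  let ?n = "length ys"
  let ?F = "\<lambda>zs s. sdsum (map (\<lambda>i. zs ! i) (sorted_list_of_set s))"
  have old: "?F (ys @ [y]) s = ?F ys s" if "s \<in> Pow {..<?n}" for s
  proof -
    have "finite s" using that finite_subset by auto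
    then have "map (\<lambda>i. (ys @ [y]) ! i) (sorted_list_of_set s) = map (\<lambda>i. ys ! i) (sorted_list_of_set s)"
      using that by (intro map_cong) (auto simp: nth_append)
    then show ?thesis by (rule arg_cong)
  qed
  have new: "?F (ys @ [y]) (insert ?n s) = ?F ys s \<oplus> y" if s: "s \<in> Pow {..<?n}" for s
  proof -
    have "finite s" "?n \<notin> s" using s finite_subset by auto
    then show ?thesis using old[OF s] by (simp add: sdsum_insort symdiff_commute)
  qed
  have "Pow {..<length (ys @ [y])} = Pow {..<?n} \<union> insert ?n ` Pow {..<?n}"
    by (simp add: lessThan_Suc Pow_insert)
  moreover have "Pow {..<?n} \<inter> insert ?n ` Pow {..<?n} = {}" by auto
  moreover have "inj_on (insert ?n) (Pow {..<?n})"
    by (rule inj_on_inverseI[of _ "\<lambda>s. s - {?n}"]) auto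
  ultimately have "(\<Prod>s\<in>Pow {..<length (ys @ [y])}. f (x \<oplus> ?F (ys @ [y]) s)) =
      (\<Prod>s\<in>Pow {..<?n}. f (x \<oplus> ?F (ys @ [y]) s)) * (\<Prod>s\<in>Pow {..<?n}. f (x \<oplus> ?F (ys @ [y]) (insert ?n s)))"
    by (simp add: prod.union_disjoint prod.reindex)
  also have "\<dots> = (\<Prod>s\<in>Pow {..<?n}. f (x \<oplus> ?F ys s)) * (\<Prod>s\<in>Pow {..<?n}. f ((x \<oplus> y) \<oplus> ?F ys s))"
    using old new by (simp add: symdiff_ac)
  also have "\<dots> = mult_derivs (ys @ [y]) f x"
    unfolding snoc.IH[symmetric] mult_derivs_append by (simp add: mult_deriv_def)
  finally show ?case ..
qed simp

lemma gowers_pow_eq_avg_lists: "gowers_pow I d f = avg (lists_of d (Pow I)) (\<lambda>ys. avg (Pow I) (mult_derivs ys f))"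
proof (induction d arbitrary: f)
  case (Suc d)
  show ?case unfolding gowers_pow.simps Suc.IH
    by (subst avg_swap) (simp add: lists_of_def avg_lists_Suc_snoc mult_derivs_append mult_derivs_mult_deriv)
qed (simp add: lists_of_0)

lemma gowers_norm_of_real:
  assumes "finite I" "d \<noteq> 0"
  shows "gowers_norm I d (\<lambda>x. complex_of_real (f x)) = gowers_pow I d f powr (1 / 2 ^ d)"
proof -
  let ?L = "{ys. length ys = d \<and> set ys \<subseteq> Pow I}"
  have "(\<Prod>s\<in>Pow {..<d}. (if even (card s) then id else cnj)
            (complex_of_real (f (x \<oplus> sdsum (map (\<lambda>i. ys ! i) (sorted_list_of_set s)))))) =
        complex_of_real (mult_derivs ys f x)" if "ys \<in> ?L" for x ys
  proof -
    have "(if even (card s) then id else cnj) (complex_of_real r) = complex_of_real r" for s :: "nat set" and r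
      by simp
    then show ?thesis using that by (simp add: mult_derivs_eq_prod)
  qed
  then have 1: "(\<Sum>x\<in>Pow I. \<Sum>ys\<in>?L. \<Prod>s\<in>Pow {..<d}. (if even (card s) then id else cnj)
            (complex_of_real (f (x \<oplus> sdsum (map (\<lambda>i. ys ! i) (sorted_list_of_set s)))))) =
     complex_of_real (\<Sum>x\<in>Pow I. \<Sum>ys\<in>?L. mult_derivs ys f x)"
    unfolding of_real_sum by (intro sum.cong refl)
  have 2: "(\<Sum>x\<in>Pow I. \<Sum>ys\<in>?L. mult_derivs ys f x) / 2 ^ (card I * (d + 1)) = gowers_pow I d f"
  proof -
    have "(\<Sum>x\<in>Pow I. \<Sum>ys\<in>?L. mult_derivs ys f x) = (\<Sum>ys\<in>lists_of d (Pow I). \<Sum>x\<in>Pow I. mult_derivs ys f x)"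
      unfolding lists_of_def by (rule sum.swap)
    moreover have "gowers_pow I d f = (\<Sum>ys\<in>lists_of d (Pow I). \<Sum>x\<in>Pow I. mult_derivs ys f x) / (2 ^ card I) / (2 ^ card I) ^ d"
      unfolding gowers_pow_eq_avg_lists avg_def sum_divide_distrib[symmetric]
      using assms(1) by (simp add: card_lists_of card_Pow)
    ultimately show ?thesis by (simp add: power_add power_mult distrib_left)
  qed
  have "gowers_norm I d (\<lambda>x. complex_of_real (f x)) =
      cmod (complex_of_real ((\<Sum>x\<in>Pow I. \<Sum>ys\<in>?L. mult_derivs ys f x) / 2 ^ (card I * (d + 1)))) powr (1 / 2 ^ d)"
    unfolding gowers_norm_def 1 of_real_divide of_real_power of_real_numeral ..
  moreover have "0 \<le> gowers_pow I d f" using gowers_pow_nonneg[of I "d - 1" f] assms(2) by simp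
  ultimately show ?thesis unfolding 2 by simp
qed

theorem theorem1p14:
  shows "\<forall>d::nat. d \<ge> 2 \<longrightarrow> (\<forall>\<epsilon>::real. \<epsilon> > 0 \<longrightarrow>
    (\<exists>n0::nat. n0 > 0 \<and> (\<forall>n\<ge>n0. \<forall>\<G>. \<G> \<subseteq> Pow (pairs_upto n) \<and> HJ_code \<G> \<and>
        prob_n n \<G> = Delta_loop n \<longrightarrow>
        gowers_norm (pairs_upto n) d
          (\<lambda>x. complex_of_real (indicator \<G> x - prob_n n \<G>)) \<le> \<epsilon>)))"
proof (intro allI impI)
  fix d :: nat and \<epsilon> :: real
  assume d: "2 \<le> d" and \<epsilon>: "0 < \<epsilon>"
  have "0 < \<epsilon> ^ (2 ^ d)" using \<epsilon> by simp
  from dense_code_gowers_pow_small[OF this, of "d - 1"] d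
  obtain \<eta> where \<eta>: "0 < \<eta>" and main: "\<And>m0. \<exists>n0. \<forall>n\<ge>n0. \<forall>a \<G>. 0 \<le> a \<longrightarrow> a \<le> 1 \<longrightarrow>
    \<G> \<subseteq> Pow (pairs_upto n) \<longrightarrow> HJ_code \<G> \<longrightarrow> Delta_loop m0 \<le> a + \<eta> \<longrightarrow> a - \<eta> \<le> prob_n n \<G> \<longrightarrow>
    gowers_pow (pairs_upto n) d (\<lambda>x. indicator \<G> x - a) < \<epsilon> ^ (2 ^ d)" by auto
  have bdd: "bdd_below (range Delta_loop)" using Delta_nonneg by (intro bdd_belowI[of _ 0]) auto
  have "Inf (range Delta_loop) < Inf (range Delta_loop) + \<eta>" using \<eta> by simp
  \<comment> \<open>With this \<open>m0\<close>, an extremal code for any \<open>n\<close> has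
    density at least \<open>Delta_loop m0 - \<eta>\<close>, so its own density can be taken as
    \<open>a\<close>.\<close>
  from cInf_lessD[OF _ this] obtain m0 where m0: "Delta_loop m0 < Inf (range Delta_loop) + \<eta>" by auto
  from main[of m0] obtain n0 where n0: "\<forall>n\<ge>n0. \<forall>a \<G>. 0 \<le> a \<longrightarrow> a \<le> 1 \<longrightarrow>
    \<G> \<subseteq> Pow (pairs_upto n) \<longrightarrow> HJ_code \<G> \<longrightarrow> Delta_loop m0 \<le> a + \<eta> \<longrightarrow> a - \<eta> \<le> prob_n n \<G> \<longrightarrow>
    gowers_pow (pairs_upto n) d (\<lambda>x. indicator \<G> x - a) < \<epsilon> ^ (2 ^ d)" ..
  show "\<exists>n0::nat. n0 > 0 \<and> (\<forall>n\<ge>n0. \<forall>\<G>. \<G> \<subseteq> Pow (pairs_upto n) \<and> HJ_code \<G> \<and>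
        prob_n n \<G> = Delta_loop n \<longrightarrow>
        gowers_norm (pairs_upto n) d (\<lambda>x. complex_of_real (indicator \<G> x - prob_n n \<G>)) \<le> \<epsilon>)"
  proof (intro exI[of _ "max 1 n0"] conjI allI impI)
    show "0 < max 1 n0" by simp
    fix n \<G> assume n: "max 1 n0 \<le> n"
      and "\<G> \<subseteq> Pow (pairs_upto n) \<and> HJ_code \<G> \<and> prob_n n \<G> = Delta_loop n"
    then have G: "\<G> \<subseteq> Pow (pairs_upto n)" "HJ_code \<G>" "prob_n n \<G> = Delta_loop n" by auto
    have a0: "0 \<le> prob_n n \<G>" unfolding prob_n_def by simp
    have "card (\<G> \<inter> Pow (pairs_upto n)) \<le> card (Pow (pairs_upto n))"
      using finite_pairs_upto[of n] by (intro card_mono) auto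
    then have a1: "prob_n n \<G> \<le> 1" unfolding prob_n_def
      using finite_pairs_upto[of n] by (simp add: card_Pow divide_le_eq flip: of_nat_power)
    have "Inf (range Delta_loop) \<le> Delta_loop n" by (rule cInf_lower[OF _ bdd]) simp
    then have "Delta_loop m0 \<le> prob_n n \<G> + \<eta>" using m0 G(3) by linarith
    then have lt: "gowers_pow (pairs_upto n) d (\<lambda>x. indicator \<G> x - prob_n n \<G>) < \<epsilon> ^ (2 ^ d)"
      using n \<eta> by (intro n0[rule_format, OF _ a0 a1 G(1,2)]) auto
    have "0 \<le> gowers_pow (pairs_upto n) d (\<lambda>x. indicator \<G> x - prob_n n \<G>)"
      using gowers_pow_nonneg[of "pairs_upto n" "d - 1"] d by (cases d) auto
    then have "gowers_pow (pairs_upto n) d (\<lambda>x. indicator \<G> x - prob_n n \<G>) powr (1 / 2 ^ d)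
        \<le> (\<epsilon> ^ (2 ^ d)) powr (1 / 2 ^ d)"
      using lt by (intro powr_mono2) auto
    also have "\<dots> = \<epsilon>"
      using \<epsilon> by (simp add: powr_powr flip: powr_realpow)
    finally show "gowers_norm (pairs_upto n) d (\<lambda>x. complex_of_real (indicator \<G> x - prob_n n \<G>)) \<le> \<epsilon>"
      using d by (subst gowers_norm_of_real) (auto simp: finite_pairs_upto)
  qed
qed

end
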